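(* Let $n\ge 2$ and let $\sigma$ be an orientation-preserving automorphism of the cancellative hoop $G_n^+$, with dual map $S$. Then $S$ is a piecewise $\mathrm{SL}_n\mathbb{Z}$-homeomorphism of $[0,1]^{n-1}$. Conversely, every piecewise $\mathrm{SL}_n\mathbb{Z}$-homeomorphism of $[0,1]^{n-1}$ is the dual map of a unique orientation-preserving automorphism of $G_n^+$.
   Context: $G_n$ is the lattice-ordered abelian group of all McNaughton functions $[0,1]^{n-1}\to\mathbb{R}$ (continuous piecewise-linear, finitely many pieces, integer coefficients) under pointwise operations; $G_n^+$ is its positive cone, which is the free cancellative hoop (operations: pointwise $+$, truncated difference $0\lor(f-g)$, $0$) on the free generators $x_1,\dots,x_n$, where $x_1,\dots,x_{n-1}$ are the coordinate projections and $x_n=\mathbf{1}-(x_1\lor\cdots\lor x_{n-1})$, $\mathbf{1}$ the constant function $1$. For an automorphism $\sigma$ of $G_n^+$, put $f_i=\sigma(x_i)$ and $f_\sharp=\sigma(\mathbf{1})=f_n+(f_1\lor\cdots\lor f_{n-1})$ (which never vanishes); its dual map is the homeomorphism $S$ of $[0,1]^{n-1}$ given by $S(p)=(f_1(p)/f_\sharp(p),\dots,f_{n-1}(p)/f_\sharp(p))$, equivalently the map with $\sigma^{-1}[\{f: f(p)=0\}]=\{f:f(S(p))=0\}$. The automorphism $\sigma$ is orientation-preserving if $S$ is orientation-preserving. A $k$-cell in $\mathbb{R}^m$ is a compact convex polyhedron of affine dimension $k$; a rational cellular complex is a finite set of cells, all of whose vertices have rational coordinates, closed under taking faces, and such that any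 two cells intersect in a common face. An orientation-preserving homeomorphism $S$ of $[0,1]^{n-1}$ is a piecewise $\mathrm{SL}_n\mathbb{Z}$-homeomorphism if there exist a rational cellular complex with support $[0,1]^{n-1}$ whose $(n-1)$-cells are $C_1,\dots,C_k$, and matrices $A_1,\dots,A_k\in\mathrm{SL}_n\mathbb{Z}$, such that for each $h$ and each $p=(\alpha_1,\dots,\alpha_{n-1})\in C_h$ with $S(p)=(\beta_1,\dots,\beta_{n-1})$, the vector $A_h(\alpha_1,\dots,\alpha_{n-1},1)^{tr}$ is a positive multiple of $(\beta_1,\dots,\beta_{n-1},1)^{tr}$. *)

theory Defs
  imports "HOL-Analysis.Analysis" "HOL-Homology.Homology" "HOL-Algebra.Bij"
begin

text \<open>
  The index type \<open>'m\<close> has \<open>n - 1\<close> elements, so \<open>real ^ 'm\<close> is the ambient space of the cube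
  \<open>[0,1]^(n-1)\<close>. Since types are nonempty, \<open>n \<ge> 2\<close> holds automatically. Functions on the cube are
  represented by extensional functions, so that equality of elements of \<open>G_n\<close> is equality on the
  cube.
\<close>

abbreviation unit_cube :: "(real ^ 'm::finite) set" where
  "unit_cube \<equiv> cbox 0 1"

definition mcnaughton :: "(real ^ 'm::finite \<Rightarrow> real) set" where
  "mcnaughton = {f \<in> extensional unit_cube.
     continuous_on unit_cube f \<and>
     (\<exists>L :: ((int ^ 'm) \<times> int) set. finite L \<and>
        (\<forall>p\<in>unit_cube. \<exists>(a, b)\<in>L. f p = (\<Sum>i\<in>UNIV. of_int (a $ i) * p $ i) + of_int b))}"

record 'a hoop = "'a partial_object" +
  hoop_plus :: "'a \<Rightarrow> 'a \<Rightarrow> 'a"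
  hoop_monus :: "'a \<Rightarrow> 'a \<Rightarrow> 'a"
  hoop_zero :: 'a

text \<open>As for groups in the library, automorphisms are extensional on the carrier; otherwise the
  junk values outside it would make uniqueness fail.\<close>

definition hoop_auto :: "'a hoop \<Rightarrow> ('a \<Rightarrow> 'a) set" where
  "hoop_auto H = {\<sigma> \<in> Bij (carrier H).
     (\<forall>f\<in>carrier H. \<forall>g\<in>carrier H. \<sigma> (hoop_plus H f g) = hoop_plus H (\<sigma> f) (\<sigma> g)) \<and>
     (\<forall>f\<in>carrier H. \<forall>g\<in>carrier H. \<sigma> (hoop_monus H f g) = hoop_monus H (\<sigma> f) (\<sigma> g)) \<and>
     \<sigma> (hoop_zero H) = hoop_zero H}"

definition G_pos :: "(real ^ 'm::finite \<Rightarrow> real) hoop" where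
  "G_pos = \<lparr>
     carrier = {f \<in> mcnaughton. \<forall>p\<in>unit_cube. 0 \<le> f p},
     hoop_plus = (\<lambda>f g. \<lambda>p\<in>unit_cube. f p + g p),
     hoop_monus = (\<lambda>f g. \<lambda>p\<in>unit_cube. max 0 (f p - g p)),
     hoop_zero = (\<lambda>p\<in>unit_cube. 0)\<rparr>"

definition proj_fun :: "'m::finite \<Rightarrow> real ^ 'm \<Rightarrow> real" where
  "proj_fun i = (\<lambda>p\<in>unit_cube. p $ i)"

definition one_fun :: "real ^ 'm::finite \<Rightarrow> real" where
  "one_fun = (\<lambda>p\<in>unit_cube. 1)"

definition dual_map ::
  "((real ^ 'm::finite \<Rightarrow> real) \<Rightarrow> (real ^ 'm \<Rightarrow> real)) \<Rightarrow> real ^ 'm \<Rightarrow> real ^ 'm" where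
  "dual_map \<sigma> p = (\<chi> i. \<sigma> (proj_fun i) p / \<sigma> one_fun p)"

text \<open>
  A self-homeomorphism of the ball \<open>D = [0,1]^m\<close> maps the boundary onto itself and acts on the
  infinite cyclic group \<open>H_m(D, \<partial>D)\<close> as \<open>id\<close> or as \<open>- id\<close>; it is orientation-preserving in the
  first case.
\<close>

definition orientation_preserving :: "(real ^ 'm::finite \<Rightarrow> real ^ 'm) \<Rightarrow> bool" where
  "orientation_preserving S \<longleftrightarrow>
     (\<forall>c \<in> carrier (relative_homology_group (int CARD('m))
                      (top_of_set unit_cube) (frontier unit_cube)).
        hom_induced (int CARD('m)) (top_of_set unit_cube) (frontier unit_cube)
                    (top_of_set unit_cube) (frontier unit_cube) S c = c)"

definition orientation_preserving_auto ::
  "((real ^ 'm::finite \<Rightarrow> real) \<Rightarrow> (real ^ 'm \<Rightarrow> real)) \<Rightarrow> bool" where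
  "orientation_preserving_auto \<sigma> \<longleftrightarrow> \<sigma> \<in> hoop_auto G_pos \<and> orientation_preserving (dual_map \<sigma>)"

text \<open>The library's \<open>face_of\<close> counts the empty set as a face, so here a complex contains the
  empty cell (of affine dimension \<open>-1\<close>).\<close>

definition rational_cell_complex :: "(real ^ 'm::finite) set set \<Rightarrow> bool" where
  "rational_cell_complex K \<longleftrightarrow>
     finite K \<and>
     (\<forall>C\<in>K. polytope C \<and> (\<forall>v. v extreme_point_of C \<longrightarrow> (\<forall>i. v $ i \<in> \<rat>))) \<and>
     (\<forall>C\<in>K. \<forall>F. F face_of C \<longrightarrow> F \<in> K) \<and>
     (\<forall>C\<in>K. \<forall>D\<in>K. (C \<inter> D) face_of C \<and> (C \<inter> D) face_of D)"

text \<open>The column \<open>(p_1, ..., p_(n-1), 1)\<close>, with \<open>None\<close> as the last index; simultaneously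
  reordering rows and columns does not affect determinants.\<close>

definition homog :: "real ^ 'm::finite \<Rightarrow> real ^ 'm option" where
  "homog p = (\<chi> i. case i of Some j \<Rightarrow> p $ j | None \<Rightarrow> 1)"

definition piecewise_SL_homeomorphism :: "(real ^ 'm::finite \<Rightarrow> real ^ 'm) \<Rightarrow> bool" where
  "piecewise_SL_homeomorphism S \<longleftrightarrow>
     (\<exists>T. homeomorphism unit_cube unit_cube S T) \<and>
     orientation_preserving S \<and>
     (\<exists>K. rational_cell_complex K \<and> \<Union>K = unit_cube \<and>
        (\<exists>A :: (real ^ 'm) set \<Rightarrow> int ^ 'm option ^ 'm option.
           \<forall>C\<in>K. aff_dim C = int CARD('m) \<longrightarrow>
             det (A C) = 1 \<and>
             (\<forall>p\<in>C. \<exists>c>0. map_matrix of_int (A C) *v homog p = c *\<^sub>R homog (S p))))"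

end

theory Submission
  imports Defs
begin

text \<open>
  For an automorphism \<open>\<sigma>\<close> and a point \<open>p\<close>, the map \<open>f \<mapsto> \<sigma> f p\<close> is a hoop homomorphism to the
  nonnegative reals, hence by compactness a positive multiple of an evaluation; this gives
  \<open>\<sigma> f = \<sigma> \<one> \<cdot> (f \<circ> S)\<close> with \<open>S\<close> the dual map. On the cells of the arrangement of the hyperplanes on which
  two of the finitely many linear pieces of the \<open>\<sigma> x_i\<close> agree, \<open>S\<close> is projective with an integer
  matrix \<open>A\<close>, and the inverse automorphism provides an integer inverse of \<open>A\<close>. Since the degree of
  \<open>S\<close> on the boundary of the cube can be computed on a small sphere, where \<open>S\<close> is its derivative up
  to positive factors, \<open>det A = 1\<close> if \<open>S\<close> preserves the orientation.

  Conversely, the positive factors of a piecewise \<open>SL\<close> homeomorphism agree at rational points, where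
  they are determined by primitive integer vectors, and hence on common faces of cells. They
  therefore glue to a continuous function \<open>\<mu>\<close>, and \<open>f \<mapsto> \<mu> \<cdot> (f \<circ> S)\<close> is the required
  automorphism. It is unique because the values of elements of \<open>G_n\<^sup>+\<close> at a rational point form a
  discrete set, whose least positive element determines \<open>\<sigma> \<one>\<close>.
\<close>

text \<open>The orientation hypothesis concerns the global group H_m(D, bd D), while det A is
  visible only inside one cell. The two are linked by the boundary map, an isomorphism because the
  cube is contractible, and by homotopies in R^m minus a point. At the end -1 and 1 must be told
  apart, which takes an explicit homology class moved by a reflection. A second obstacle is that a
  McNaughton function is given by continuity and a pointwise choice among finitely many integer
  forms, with no complex attached. Cells on which the choice is constant have to be manufactured:
  between the hyperplanes the forms are linearly ordered, and connectedness then forbids switching.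
  In homogeneous coordinates the positive factor is the last coordinate of A (p, 1), hence affine in
  p. This is why agreement at the rational vertices of a face suffices for gluing, and why
  multiplication by the factor turns a composite with a projective map back into integer affine
  pieces.\<close>

subsection \<open>Degrees of linear maps on punctured Euclidean space\<close>

text \<open>A relation rather than a function, so no generator of the homology group has to be
  chosen; only -1 and 1 ever have to be told apart. Reduced homology also covers m = 1, where the
  punctured line has two components.\<close>

definition punctured_degree :: "(real ^ 'm::finite \<Rightarrow> real ^ 'm) \<Rightarrow> int \<Rightarrow> bool" where
  "punctured_degree f d \<longleftrightarrow>
     continuous_map (top_of_set (- {0})) (top_of_set (- {0})) f \<and>
     (\<forall>c \<in> carrier (reduced_homology_group (int CARD('m) - 1) (top_of_set (- {0 :: real ^ 'm}))).
        hom_induced (int CARD('m) - 1) (top_of_set (- {0})) {} (top_of_set (- {0})) {} f c =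
        c [^]\<^bsub>reduced_homology_group (int CARD('m) - 1) (top_of_set (- {0 :: real ^ 'm}))\<^esub> d)"

lemma punctured_degree_compose:
  fixes f g :: "real ^ 'm::finite \<Rightarrow> real ^ 'm"
  assumes f: "punctured_degree f d" and g: "punctured_degree g e"
  shows "punctured_degree (f \<circ> g) (d * e)"
proof -
  let ?Z = "top_of_set (- {0 :: real ^ 'm})" and ?k = "int CARD('m) - 1"
  let ?G = "reduced_homology_group ?k ?Z"
  have cf: "continuous_map ?Z ?Z f" and cg: "continuous_map ?Z ?Z g"
    using f g by (auto simp: punctured_degree_def)
  interpret group ?G by simp
  have "hom_induced ?k ?Z {} ?Z {} (f \<circ> g) c = c [^]\<^bsub>?G\<^esub> (d * e)" if c: "c \<in> carrier ?G" for c
  proof -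
    have "hom_induced ?k ?Z {} ?Z {} (f \<circ> g) c = hom_induced ?k ?Z {} ?Z {} f (c [^]\<^bsub>?G\<^esub> e)"
      using g c by (simp add: hom_induced_compose_empty[OF cg cf] punctured_degree_def)
    also have "\<dots> = c [^]\<^bsub>?G\<^esub> (e * d)"
      using f c by (simp add: punctured_degree_def int_pow_pow)
    finally show ?thesis by (simp add: mult.commute)
  qed
  then show ?thesis
    using continuous_map_compose[OF cg cf] by (simp add: punctured_degree_def)
qed

lemma punctured_degree_homotopic:
  fixes f g :: "real ^ 'm::finite \<Rightarrow> real ^ 'm"
  assumes "homotopic_with (\<lambda>_. True) (top_of_set (- {0})) (top_of_set (- {0})) f g"
    and "punctured_degree g d"
  shows "punctured_degree f d"
  using assms homology_homotopy_empty[OF assms(1), of "int CARD('m) - 1"]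
    homotopic_with_imp_continuous_maps[OF assms(1)]
  by (simp add: punctured_degree_def)

lemma punctured_degree_id: "punctured_degree id 1"
  by (auto simp: punctured_degree_def hom_induced_id group.int_pow_1
      subsetD[OF carrier_reduced_homology_group_subset])

lemma punctured_degree_segment_homotopic:
  fixes f g :: "real ^ 'm::finite \<Rightarrow> real ^ 'm"
  assumes "linear f" "linear g" and d: "punctured_degree g d"
    and nz: "\<And>t x. 0 \<le> t \<Longrightarrow> t \<le> 1 \<Longrightarrow> x \<noteq> 0 \<Longrightarrow> (1 - t) *\<^sub>R f x + t *\<^sub>R g x \<noteq> 0"
  shows "punctured_degree f d"
proof (rule punctured_degree_homotopic[OF _ d])
  show "homotopic_with_canon (\<lambda>_. True) (- {0}) (- {0}) f g"
    by (rule homotopic_with_linear)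
      (use nz assms in \<open>auto simp: closed_segment_def linear_continuous_on linear_conv_bounded_linear\<close>)
qed

definition reflect_coord :: "'m::finite \<Rightarrow> real ^ 'm \<Rightarrow> real ^ 'm" where
  "reflect_coord i x = (\<chi> j. if j = i then - x $ j else x $ j)"

lemma linear_reflect_coord: "linear (reflect_coord i)"
  by (auto simp: reflect_coord_def linear_iff vec_eq_iff)

lemma reflect_coord_nonzero: "x \<noteq> 0 \<Longrightarrow> reflect_coord i x \<noteq> 0"
  by (auto simp: reflect_coord_def vec_eq_iff split: if_splits)

text \<open>The degree of the first-coordinate reflection of the standard sphere, whose points are
  functions on the naturals, is transported to R^m; \<open>i0\<close> is the index that corresponds
  to coordinate 0. The class \<open>c\<close> is what later distinguishes degree -1 from degree
  1.\<close>

lemma punctured_degree_reflection: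
  obtains i0 :: "'m::finite" and c where
    "punctured_degree (reflect_coord i0) (- 1)"
    "c \<in> carrier (reduced_homology_group (int CARD('m) - 1) (top_of_set (- {0 :: real ^ 'm})))"
    "hom_induced (int CARD('m) - 1) (top_of_set (- {0})) {} (top_of_set (- {0})) {}
       (reflect_coord i0) c \<noteq> c"
proof -
  \<comment> \<open>The unit sphere of R^m has dimension m - 1, and its coordinates are numbered
    from 0 to \<open>n\<close>.\<close>
  define n where "n = CARD('m) - 1"
  have n: "CARD('m) = Suc n" by (simp add: n_def)
  obtain b :: "nat \<Rightarrow> 'm" where b: "bij_betw b {..n} UNIV"
    using ex_bij_betw_nat_finite[OF finite_class.finite_UNIV] n
    by (metis atLeast0LessThan lessThan_Suc_atMost)
  define bi where "bi = inv_into {..n} b"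
  have bi: "bi i \<le> n" "b (bi i) = i" for i
    using b inv_into_into[of i b "{..n}"] f_inv_into_f[of i b "{..n}"] by (auto simp: bi_def bij_betw_def)
  have bib: "k \<le> n \<Longrightarrow> bi (b k) = k" for k
    using b by (auto simp: bi_def bij_betw_def)
  let ?Z = "top_of_set (- {0 :: real ^ 'm})" and ?N = "nsphere n"
  let ?G = "reduced_homology_group (int n) ?Z" and ?H = "reduced_homology_group (int n) ?N"
  \<comment> \<open>\<open>\<phi>\<close> includes the unit sphere into the punctured space and
    \<open>\<psi>\<close> projects radially onto it. They are inverse homotopy equivalences, and one
    composite is exactly the identity of the sphere.\<close>
  define \<phi> :: "(nat \<Rightarrow> real) \<Rightarrow> real ^ 'm" where "\<phi> x = (\<chi> i. x (bi i))" for x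
  define \<psi> :: "real ^ 'm \<Rightarrow> nat \<Rightarrow> real" where "\<psi> y = (\<lambda>k. if k \<le> n then y $ b k / norm y else 0)" for y
  define r :: "(nat \<Rightarrow> real) \<Rightarrow> nat \<Rightarrow> real" where "r = (\<lambda>x i. if i = 0 then -x i else x i)"
  define Sn :: "(nat \<Rightarrow> real) set" where "Sn = {x. (\<Sum>i\<le>n. x i ^ 2) = 1 \<and> (\<forall>i>n. x i = 0)}"
  have N: "?N = top_of_set Sn"
    by (simp add: nsphere Sn_def euclidean_product_topology)
  have norm2: "(norm y)\<^sup>2 = (\<Sum>k\<le>n. (y $ b k)\<^sup>2)" for y :: "real ^ 'm"
    using sum.reindex_bij_betw[OF b, of "\<lambda>i. (y $ i)\<^sup>2"]
    unfolding power2_norm_eq_inner inner_vec_def by (simp add: power2_eq_square)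
  have norm\<phi>: "norm (\<phi> x) = 1" if "x \<in> Sn" for x
    using that norm2[of "\<phi> x"] by (simp add: \<phi>_def Sn_def bib power2_eq_1_iff) (metis norm_ge_zero le_minus_one_simps(3))
  have c\<phi>: "continuous_map ?N ?Z \<phi>"
  proof -
    have "continuous_on Sn \<phi>"
      unfolding \<phi>_def
      by (intro continuous_on_vec_lambda continuous_on_subset[OF continuous_on_product_coordinates]) auto
    moreover have "\<phi> x \<noteq> 0" if "x \<in> Sn" for x
      using norm\<phi>[OF that] by auto
    ultimately show ?thesis by (auto simp: N)
  qed
  have c\<psi>: "continuous_map ?Z ?N \<psi>"
  proof -
    have "continuous_on (- {0}) \<psi>"
    proof (rule continuous_on_coordinatewise_then_product)
      show "continuous_on (- {0}) (\<lambda>y. \<psi> y k)" for k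
        unfolding \<psi>_def by (cases "k \<le> n") (auto intro!: continuous_intros)
    qed
    moreover have "\<psi> y \<in> Sn" if "y \<noteq> 0" for y
      using that by (simp add: \<psi>_def Sn_def power_divide norm2[symmetric] flip: sum_divide_distrib)
    ultimately show ?thesis by (auto simp: N)
  qed
  have cr: "continuous_map ?N ?N r"
    unfolding r_def by (rule continuous_map_nsphere_reflection)
  have cR: "continuous_map ?Z ?Z (reflect_coord (b 0))"
    using linear_reflect_coord[of "b 0"]
    by (auto simp: reflect_coord_nonzero linear_continuous_on linear_conv_bounded_linear)
  have \<psi>\<phi>: "(\<psi> \<circ> \<phi>) x = x" if "x \<in> topspace ?N" for x
    using that norm\<phi>[of x] by (auto simp: N \<psi>_def \<phi>_def bib Sn_def fun_eq_iff)
  have \<phi>\<psi>: "homotopic_with (\<lambda>_. True) ?Z ?Z (\<phi> \<circ> \<psi>) id"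
  proof (rule homotopic_with_linear)
    show "continuous_on (- {0}) (\<phi> \<circ> \<psi>)"
      using continuous_map_compose[OF c\<psi> c\<phi>] by simp
    fix y :: "real ^ 'm" assume "y \<in> - {0}"
    then have y: "norm y > 0" by simp
    have eq: "(\<phi> \<circ> \<psi>) y = (1 / norm y) *\<^sub>R y"
      by (simp add: \<phi>_def \<psi>_def bi vec_eq_iff)
    have "(1 - t) * (1 / norm y) + t > 0" if "0 \<le> t" "t \<le> 1" for t
      using y that by (cases "t = 0") (auto intro: add_nonneg_pos)
    then have "((1 - t) * (1 / norm y) + t) *\<^sub>R y \<noteq> 0" if "0 \<le> t" "t \<le> 1" for t
      using y that by (metis less_irrefl norm_zero scaleR_eq_0_iff)
    then show "closed_segment ((\<phi> \<circ> \<psi>) y) (id y) \<subseteq> - {0}"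
      unfolding eq by (auto simp: closed_segment_def scaleR_add_left)
  qed auto
  have R\<phi>: "reflect_coord (b 0) \<circ> \<phi> = \<phi> \<circ> r"
    using bi bib by (auto simp: fun_eq_iff reflect_coord_def \<phi>_def r_def vec_eq_iff) (metis bi(2))+
  let ?h = "hom_induced (int n)"
  have HH: "?h ?N {} ?N {} r x = x [^]\<^bsub>?H\<^esub> (- 1 :: int)" if "x \<in> carrier ?H" for x
    using Brouwer_degree2[OF that, of r] Brouwer_degree2_reflection[of n] by (simp add: r_def)
  have \<phi>hom: "?h ?N {} ?Z {} \<phi> \<in> hom ?H ?G"
    by (rule hom_induced_reduced_hom)
  have "?h ?Z {} ?Z {} (reflect_coord (b 0)) c = c [^]\<^bsub>?G\<^esub> (- 1 :: int)" if c: "c \<in> carrier ?G" for c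
  proof -
    let ?d = "?h ?Z {} ?N {} \<psi> c"
    have d: "?d \<in> carrier ?H" by (rule hom_induced_reduced[OF c])
    have cd: "c = ?h ?N {} ?Z {} \<phi> ?d"
      using fun_cong[OF homology_homotopy_empty[OF \<phi>\<psi>, of "int n"], of c]
        subsetD[OF carrier_reduced_homology_group_subset c]
      by (simp add: hom_induced_compose_empty[OF c\<psi> c\<phi>] hom_induced_id)
    have "?h ?Z {} ?Z {} (reflect_coord (b 0)) c = ?h ?N {} ?Z {} (\<phi> \<circ> r) ?d"
      by (subst cd) (simp flip: R\<phi> add: hom_induced_compose_empty[OF c\<phi> cR])
    also have "\<dots> = ?h ?N {} ?Z {} \<phi> (?d [^]\<^bsub>?H\<^esub> (- 1 :: int))"
      by (simp add: hom_induced_compose_empty[OF cr c\<phi>] HH[OF d])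
    also have "\<dots> = (?h ?N {} ?Z {} \<phi> ?d) [^]\<^bsub>?G\<^esub> (- 1 :: int)"
      using \<phi>hom d by (meson group_hom.hom_int_pow group_hom_axioms.intro group_hom_def group_reduced_homology_group)
    finally show ?thesis using cd by simp
  qed
  then have deg: "punctured_degree (reflect_coord (b 0)) (- 1)"
    using cR by (simp add: punctured_degree_def n)
  obtain a where a: "a \<in> carrier ?H" "a \<noteq> \<one>\<^bsub>?H\<^esub>"
    using trivial_reduced_homology_group_nsphere[of n n] group.trivial_group_alt[of ?H]
    by (metis group_reduced_homology_group singletonI subsetI)
  \<comment> \<open>A nontrivial element of an infinite cyclic group differs from its inverse: by
    \<open>Brouwer_degree2_iff\<close>, \<open>r\<close> could fix \<open>a\<close> only if its
    degree were 1.\<close>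
  have ha: "?h ?N {} ?N {} r a \<noteq> a"
    using Brouwer_degree2_iff[OF cr a(1), of 1] Brouwer_degree2_reflection[of n] a
    by (simp add: r_def group.int_pow_1)
  let ?c = "?h ?N {} ?Z {} \<phi> a"
  \<comment> \<open>\<open>\<psi>\<close> recovers \<open>a\<close> from its image, so the
    inequality survives in the punctured space.\<close>
  have \<psi>c: "?h ?Z {} ?N {} \<psi> ?c = a"
    using fun_cong[OF hom_induced_compose_empty[OF c\<phi> c\<psi>, of "int n"], of a]
      hom_induced_id_gen[OF continuous_map_compose[OF c\<phi> c\<psi>] \<psi>\<phi>]
      subsetD[OF carrier_reduced_homology_group_subset a(1)] by simp
  have "?h ?Z {} ?Z {} (reflect_coord (b 0)) ?c = ?h ?N {} ?Z {} \<phi> (?h ?N {} ?N {} r a)"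
    using fun_cong[OF hom_induced_compose_empty[OF c\<phi> cR, of "int n"], of a]
      fun_cong[OF hom_induced_compose_empty[OF cr c\<phi>, of "int n"], of a] by (simp add: R\<phi>)
  then have "?h ?Z {} ?N {} \<psi> (?h ?Z {} ?Z {} (reflect_coord (b 0)) ?c) = ?h ?N {} ?N {} r a"
    using fun_cong[OF hom_induced_compose_empty[OF c\<phi> c\<psi>, of "int n"], of "?h ?N {} ?N {} r a"]
      hom_induced_id_gen[OF continuous_map_compose[OF c\<phi> c\<psi>] \<psi>\<phi>] hom_induced_carrier[of "int n" ?N "{}" ?N "{}" r a]
    by simp
  then have ne: "?h ?Z {} ?Z {} (reflect_coord (b 0)) ?c \<noteq> ?c"
    using \<psi>c ha by auto
  have "?c \<in> carrier ?G" by (rule hom_induced_reduced[OF a(1)])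
  then show ?thesis
    using that[OF deg, of ?c] ne by (simp add: n)
qed

definition quarter_turn :: "'m::finite \<Rightarrow> 'm \<Rightarrow> real ^ 'm \<Rightarrow> real ^ 'm" where
  "quarter_turn i k x = (\<chi> j. if j = i then - x $ k else if j = k then x $ i else x $ j)"

lemma linear_quarter_turn: "linear (quarter_turn i k)"
  by (auto simp: quarter_turn_def linear_iff vec_eq_iff)

text \<open>On the plane of the coordinates i and k, the segment from the rotation to the identity
  has determinant t^2 + (1 - t)^2, which never vanishes; the other coordinates are fixed
  throughout.\<close>

lemma punctured_degree_quarter_turn:
  assumes "i \<noteq> k"
  shows "punctured_degree (quarter_turn i k) 1"
proof (rule punctured_degree_segment_homotopic[OF linear_quarter_turn linear_id punctured_degree_id])
  fix t :: real and x :: "real ^ 'a"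
  assume "x \<noteq> 0"
  show "(1 - t) *\<^sub>R quarter_turn i k x + t *\<^sub>R id x \<noteq> 0"
  proof
    assume eq: "(1 - t) *\<^sub>R quarter_turn i k x + t *\<^sub>R id x = 0"
    have i: "(t - 1) * x $ k + t * x $ i = 0"
      using arg_cong[OF eq, of "\<lambda>v. v $ i"] by (simp add: quarter_turn_def algebra_simps)
    have k: "(1 - t) * x $ i + t * x $ k = 0"
      using arg_cong[OF eq, of "\<lambda>v. v $ k"] assms by (simp add: quarter_turn_def algebra_simps)
    have j: "x $ j = 0" if "j \<noteq> i" "j \<noteq> k" for j
      using arg_cong[OF eq, of "\<lambda>v. v $ j"] that by (simp add: quarter_turn_def algebra_simps)
    have pos: "t\<^sup>2 + (1 - t)\<^sup>2 \<noteq> 0"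
      by (simp add: sum_power2_eq_zero_iff)
    \<comment> \<open>The multipliers form a row of the adjugate of the 2 by 2 system given by
      \<open>i\<close> and \<open>k\<close>.\<close>
    have "(t\<^sup>2 + (1 - t)\<^sup>2) * x $ i = t * ((t - 1) * x $ k + t * x $ i) + (1 - t) * ((1 - t) * x $ i + t * x $ k)"
      by (simp add: power2_eq_square algebra_simps)
    then have xi: "x $ i = 0" unfolding i k using pos by auto
    have "(t\<^sup>2 + (1 - t)\<^sup>2) * x $ k = (t - 1) * ((t - 1) * x $ k + t * x $ i) + t * ((1 - t) * x $ i + t * x $ k)"
      by (simp add: power2_eq_square algebra_simps)
    then have "x $ k = 0" unfolding i k using pos by auto
    with xi j have "x = 0" unfolding vec_eq_iff by (metis zero_index)
    with \<open>x \<noteq> 0\<close> show False by simp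
  qed
qed

text \<open>The square of a quarter turn negates both coordinates of its plane, so composing it with
  one reflection gives the other.\<close>

lemma punctured_degree_reflect_coord: "punctured_degree (reflect_coord i) (- 1)"
proof -
  obtain i0 :: 'a where i0: "punctured_degree (reflect_coord i0) (- 1)"
    by (rule punctured_degree_reflection)
  show ?thesis
  proof (cases "i = i0")
    case False
    have "reflect_coord i = quarter_turn i i0 \<circ> (quarter_turn i i0 \<circ> reflect_coord i0)"
      using False by (auto simp: fun_eq_iff reflect_coord_def quarter_turn_def vec_eq_iff)
    then show ?thesis
      using punctured_degree_compose[OF punctured_degree_quarter_turn[OF False]
          punctured_degree_compose[OF punctured_degree_quarter_turn[OF False] i0]] by simp
  qed (use i0 in simp)
qed

lemma punctured_degree_sign_change:
  assumes "finite I"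
  shows "punctured_degree (\<lambda>x. \<chi> j. if j \<in> I then - x $ j else x $ j) ((- 1) ^ card I)"
  using assms
proof induction
  case empty
  have "(\<lambda>x. \<chi> j. if j \<in> {} then - x $ j else x $ j) = (id :: real ^ 'a \<Rightarrow> _)"
    by (auto simp: vec_eq_iff)
  then show ?case by (simp add: punctured_degree_id)
next
  case (insert i I)
  have "(\<lambda>x. \<chi> j. if j \<in> insert i I then - x $ j else x $ j) =
      reflect_coord i \<circ> (\<lambda>x. \<chi> j. if j \<in> I then - x $ j else x $ j)"
    using insert.hyps by (auto simp: fun_eq_iff reflect_coord_def vec_eq_iff)
  then show ?case
    using punctured_degree_compose[OF punctured_degree_reflect_coord[of i] insert.IH] insert.hyps
    by simp
qed

text \<open>Degree and sign of the determinant are both multiplicative, so elementary factors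
  suffice. A zero row is excluded by the determinant, a diagonal matrix deforms to its signs, a
  shear deforms to the identity, and a transposition is a reflection followed by a quarter
  turn.\<close>

lemma punctured_degree_matrix:
  fixes A :: "real ^ 'm::finite ^ 'm"
  assumes "det A \<noteq> 0"
  shows "punctured_degree ((*v) A) (if det A > 0 then 1 else - 1)"
proof -
  let ?P = "\<lambda>A :: real ^ 'm ^ 'm. det A \<noteq> 0 \<longrightarrow> punctured_degree ((*v) A) (if det A > 0 then 1 else - 1)"
  have "?P A"
  proof (rule induct_matrix_elementary[of ?P])
    fix A B :: "real ^ 'm ^ 'm"
    assume A: "?P A" and B: "?P B"
    show "?P (A ** B)"
    proof
      assume "det (A ** B) \<noteq> 0"
      then have nz: "det A \<noteq> 0" "det B \<noteq> 0" by (auto simp: det_mul)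
      have "(*v) (A ** B) = (*v) A \<circ> (*v) B"
        by (rule matrix_vector_mult_matrix_matrix_mult_compose)
      moreover have "(if det (A ** B) > 0 then 1 else - 1 :: int) =
          (if det A > 0 then 1 else - 1) * (if det B > 0 then 1 else - 1)"
        using nz by (auto simp: det_mul zero_less_mult_iff)
      ultimately show "punctured_degree ((*v) (A ** B)) (if det (A ** B) > 0 then 1 else - 1)"
        using punctured_degree_compose[of "(*v) A" _ "(*v) B"] A B nz by metis
    qed
  next
    fix A :: "real ^ 'm ^ 'm" and i
    assume "row i A = 0"
    then show "?P A" by (simp add: det_zero_row)
  next
    fix A :: "real ^ 'm ^ 'm"
    assume diag: "\<And>i j. i \<noteq> j \<Longrightarrow> A $ i $ j = 0"
    show "?P A"
    proof
      assume nz: "det A \<noteq> 0"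
      have det: "det A = (\<Prod>i\<in>UNIV. A $ i $ i)"
        by (rule det_diagonal[OF diag])
      have nz_i: "A $ i $ i \<noteq> 0" for i
        using nz by (simp add: det)
      let ?I = "{i. A $ i $ i < 0}"
      have Ax: "(A *v x) $ i = A $ i $ i * x $ i" for x i
      proof -
        have "A $ i $ j * x $ j = (if j = i then A $ i $ i * x $ i else 0)" for j
          using diag[of i j] by auto
        then have "(\<Sum>j\<in>UNIV. A $ i $ j * x $ j) = (\<Sum>j\<in>UNIV. if j = i then A $ i $ i * x $ i else 0)"
          by (rule sum.cong[OF refl])
        then show ?thesis by (simp add: matrix_vector_mult_def)
      qed
      \<comment> \<open>Each negative diagonal entry contributes one factor -1, so the parity of
        their number gives the sign of the determinant.\<close>
      have sgn: "(\<Prod>i\<in>J. A $ i $ i) * (- 1) ^ card (J \<inter> ?I) > 0" if "finite J" for J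
        using that
      proof induction
        case (insert j J)
        show ?case
        proof (cases "A $ j $ j < 0")
          case True
          then have "insert j J \<inter> ?I = insert j (J \<inter> ?I)" by auto
          then show ?thesis
            using insert True mult_pos_pos[of "- A $ j $ j", OF _ insert.IH]
            by (simp add: mult.assoc)
        next
          case False
          then have "insert j J \<inter> ?I = J \<inter> ?I" "A $ j $ j > 0" using nz_i[of j] by auto
          then show ?thesis
            using insert mult_pos_pos[of "A $ j $ j", OF _ insert.IH] by (simp add: mult.assoc)
        qed
      qed simp
      have e: "(- 1) ^ card ?I = (if det A > 0 then 1 else - 1 :: int)"
        using sgn[of UNIV] by (cases "even (card ?I)") (auto simp: det)
      show "punctured_degree ((*v) A) (if det A > 0 then 1 else - 1)"
        unfolding e[symmetric]
      proof (rule punctured_degree_segment_homotopic[OF _ _ punctured_degree_sign_change])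
        show "linear ((*v) A)" by simp
        show "linear (\<lambda>x :: real ^ 'm. \<chi> j. if j \<in> ?I then - x $ j else x $ j)"
          by (auto simp: linear_iff vec_eq_iff)
        fix t :: real and x :: "real ^ 'm"
        assume t: "0 \<le> t" "t \<le> 1" and "x \<noteq> 0"
        then obtain j where j: "x $ j \<noteq> 0" by (auto simp: vec_eq_iff)
        \<comment> \<open>Between a nonzero diagonal entry and its own sign no value is 0.\<close>
        have "(1 - t) * A $ j $ j + t * (if j \<in> ?I then - 1 else 1) \<noteq> 0"
        proof (cases "A $ j $ j < 0")
          case True
          then have "(1 - t) * - (A $ j $ j) \<ge> 0"
            using t by (intro mult_nonneg_nonneg) auto
          then have "(1 - t) * - (A $ j $ j) + t > 0"
            using True t by (cases "t = 0") (simp, linarith)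
          then show ?thesis using True by simp
        next
          case False
          then have "(1 - t) * A $ j $ j + t > 0"
            using t nz_i[of j] by (cases "t = 0") (auto intro!: add_nonneg_pos)
          then show ?thesis using False by simp
        qed
        then have "((1 - t) * A $ j $ j + t * (if j \<in> ?I then - 1 else 1)) * x $ j \<noteq> 0"
          using j by simp
        moreover have "((1 - t) *\<^sub>R (A *v x) + t *\<^sub>R (\<chi> j. if j \<in> ?I then - x $ j else x $ j)) $ j =
            ((1 - t) * A $ j $ j + t * (if j \<in> ?I then - 1 else 1)) * x $ j"
          by (simp add: Ax algebra_simps)
        ultimately show "(1 - t) *\<^sub>R (A *v x) + t *\<^sub>R (\<chi> j. if j \<in> ?I then - x $ j else x $ j) \<noteq> 0"
          by (metis zero_index)
      qed simp
    qed
  next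
    fix m n :: 'm
    assume mn: "m \<noteq> n"
    let ?A = "\<chi> i j. mat 1 $ i $ Transposition.transpose m n j :: real ^ 'm ^ 'm"
    have "det ?A = - 1"
    proof -
      have "det ?A = det (transpose ?A)" by simp
      also have "transpose ?A = (\<chi> i. mat 1 $ Transposition.transpose m n i)"
        by (auto simp: vec_eq_iff transpose_def mat_def)
      also have "det \<dots> = - det (mat 1 :: real ^ 'm ^ 'm)"
        using mn by (simp add: det_permute_rows permutes_swap_id sign_swap_id)
      finally show ?thesis by simp
    qed
    moreover have "(*v) ?A = quarter_turn m n \<circ> reflect_coord n"
    proof (rule ext, rule vec_eq_iff[THEN iffD2, OF allI])
      fix x :: "real ^ 'm" and i
      have "(i = Transposition.transpose m n j) = (j = Transposition.transpose m n i)" for j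
        by (metis transpose_involutory)
      then have "(?A *v x) $ i = (\<Sum>j\<in>UNIV. if j = Transposition.transpose m n i then x $ j else 0)"
        by (simp add: matrix_vector_mult_def mat_def mult_delta_left)
      also have "\<dots> = x $ Transposition.transpose m n i" by simp
      finally show "(?A *v x) $ i = (quarter_turn m n \<circ> reflect_coord n) x $ i"
        using mn by (auto simp: quarter_turn_def reflect_coord_def Transposition.transpose_def)
    qed
    ultimately show "?P ?A"
      using punctured_degree_compose[OF punctured_degree_quarter_turn[OF mn] punctured_degree_reflect_coord[of n]]
      by simp
  next
    fix m n :: 'm and c :: real
    assume mn: "m \<noteq> n"
    let ?A = "\<chi> i j. if i = m \<and> j = n then c else of_bool (i = j) :: real ^ 'm ^ 'm"
    have "?A = (\<chi> k. if k = m then row m (mat 1) + c *s row n (mat 1) else row k (mat 1))"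
      using mn by (auto simp: vec_eq_iff row_def mat_def)
    then have "det ?A = 1"
      using det_row_operation[OF mn, of "mat 1" c] by simp
    have Ax: "?A *v x = x + (c * x $ n) *\<^sub>R axis m 1" for x
    proof (rule vec_eq_iff[THEN iffD2, OF allI])
      fix i
      have "(?A *v x) $ i = (\<Sum>j\<in>UNIV. (if j = i then x $ j else 0) + (if j = n then if i = m then c * x $ j else 0 else 0))"
        unfolding matrix_vector_mult_def using mn by (auto intro!: sum.cong)
      also have "\<dots> = x $ i + (if i = m then c * x $ n else 0)"
        by (simp add: sum.distrib)
      finally show "(?A *v x) $ i = (x + (c * x $ n) *\<^sub>R axis m 1) $ i"
        by (simp add: axis_def)
    qed
    have "punctured_degree ((*v) ?A) 1"
    proof (rule punctured_degree_segment_homotopic[OF _ linear_id punctured_degree_id])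
      fix t :: real and x :: "real ^ 'm"
      assume x: "x \<noteq> 0"
      show "(1 - t) *\<^sub>R (?A *v x) + t *\<^sub>R id x \<noteq> 0"
      proof
        assume eq: "(1 - t) *\<^sub>R (?A *v x) + t *\<^sub>R id x = 0"
        \<comment> \<open>Only row \<open>m\<close> of the interpolated shear differs from the
          identity. Row \<open>n\<close> therefore gives \<open>x $ n = 0\<close>, and the
          off-diagonal term disappears.\<close>
        have eq': "x $ i + (if i = m then (1 - t) * (c * x $ n) else 0) = 0" for i
          using arg_cong[OF eq, of "\<lambda>v. v $ i"] by (simp add: Ax axis_def algebra_simps split: if_splits)
        have "x $ n = 0" using eq'[of n] mn by simp
        then have "x $ i = 0" for i using eq'[of i] by (simp split: if_splits)
        then have "x = 0" by (simp add: vec_eq_iff)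
        with x show False by simp
      qed
    qed simp
    with \<open>det ?A = 1\<close> show "?P ?A" by simp
  qed
  with assms show ?thesis by simp
qed

text \<open>The definition leaves the degree non-unique a priori. The class \<open>c\<close> moved
  by a reflection, which also has degree -1, rules out degree 1.\<close>

lemma not_punctured_degree_1_if_det_neg:
  fixes A :: "real ^ 'm::finite ^ 'm"
  assumes "det A < 0"
  shows "\<not> punctured_degree ((*v) A) 1"
proof
  assume 1: "punctured_degree ((*v) A) 1"
  obtain i0 :: 'm and c where "punctured_degree (reflect_coord i0) (- 1)"
    and c: "c \<in> carrier (reduced_homology_group (int CARD('m) - 1) (top_of_set (- {0 :: real ^ 'm})))"
    and "hom_induced (int CARD('m) - 1) (top_of_set (- {0})) {} (top_of_set (- {0})) {}
           (reflect_coord i0) c \<noteq> c"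
    by (rule punctured_degree_reflection)
  then show False
    using 1 punctured_degree_matrix[of A] assms by (auto simp: punctured_degree_def group.int_pow_1)
qed

subsection \<open>Derivatives of projective maps\<close>

lemma sum_UNIV_option:
  fixes f :: "'m::finite option \<Rightarrow> 'a::comm_monoid_add"
  shows "(\<Sum>i\<in>UNIV. f i) = f None + (\<Sum>i\<in>UNIV. f (Some i))"
  by (simp add: UNIV_option_conv sum.reindex)

lemma prod_UNIV_option:
  fixes f :: "'m::finite option \<Rightarrow> 'a::comm_monoid_mult"
  shows "(\<Prod>i\<in>UNIV. f i) = f None * (\<Prod>i\<in>UNIV. f (Some i))"
  by (simp add: UNIV_option_conv prod.reindex)

lemma map_option_permutes: "p permutes UNIV \<Longrightarrow> map_option p permutes UNIV"
proof -
  assume "p permutes UNIV"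
  then have "map_option (inv_into UNIV p) \<circ> map_option p = id" "map_option p \<circ> map_option (inv_into UNIV p) = id"
    by (auto simp: fun_eq_iff permutes_inverses option.map_comp o_def option.map_ident)
  then have "bij (map_option p)" by (rule o_bij)
  then show ?thesis using bij_imp_permutes[of "map_option p" UNIV] by auto
qed

lemma sign_map_option:
  fixes p :: "'m::finite \<Rightarrow> 'm"
  assumes "p permutes UNIV"
  shows "sign (map_option p) = sign p"
  using assms finite_class.finite_UNIV
proof (induction rule: permutes_induct)
  case id
  then show ?case by (metis option.map_id0 sign_id)
next
  case (swap a b p)
  have eq: "map_option (Transposition.transpose a b \<circ> p) = Transposition.transpose (Some a) (Some b) \<circ> map_option p"
    by (auto simp: fun_eq_iff Transposition.transpose_def map_option_case split: option.split)
  have perm: "permutation (map_option p)" "permutation p"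
    using swap map_option_permutes[of p] by (auto simp: permutation_permutes)
  show ?case
    unfolding eq sign_compose[OF permutation_swap_id perm(1)] sign_compose[OF permutation_swap_id perm(2)]
    using swap by (simp add: sign_swap_id)
qed

text \<open>In the Leibniz sum, a permutation sending some \<open>Some i\<close> to
  \<open>None\<close> picks up a zero entry; the survivors fix \<open>None\<close> and come from
  permutations of the smaller index type.\<close>

lemma det_option_block:
  fixes N :: "'a::comm_ring_1 ^ 'm::finite option ^ 'm option"
  assumes N: "\<And>i. N $ Some i $ None = 0"
  shows "det N = N $ None $ None * det (\<chi> i j. N $ Some i $ Some j)"
proof -
  let ?f = "\<lambda>p. of_int (sign p) * (\<Prod>i\<in>UNIV. N $ i $ p i)"
  let ?T = "map_option ` {q. q permutes (UNIV :: 'm set)}"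
  have zero: "?f p = 0" if p: "p permutes UNIV" "p \<notin> ?T" for p
  proof (rule ccontr)
    assume nz: "?f p \<noteq> 0"
    have "p (Some i) \<noteq> None" for i
    proof
      assume "p (Some i) = None"
      then have "(\<Prod>i\<in>UNIV. N $ i $ p i) = 0"
        using N[of i] by (intro prod_zero) (auto intro!: exI[of _ "Some i"])
      with nz show False by simp
    qed
    moreover define q where "q = (\<lambda>i. the (p (Some i)))"
    ultimately have q: "p (Some i) = Some (q i)" for i by auto
    have inj: "inj p" using p permutes_inj by blast
    have "inj q"
    proof (rule injI)
      fix x y assume "q x = q y"
      then have "p (Some x) = p (Some y)" by (simp add: q)
      then show "x = y" using inj by (simp add: inj_eq)
    qed
    then have "bij q" by (simp add: finite_UNIV_inj_surj bij_betw_def)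
    moreover have "p None = None"
    proof (cases "p None")
      case (Some k)
      obtain i where "k = q i" using \<open>bij q\<close> by (metis bij_pointE)
      then have "p (Some i) = p None" by (simp add: q Some)
      then have "Some i = None" using inj by (simp only: inj_eq)
      then show ?thesis by simp
    qed
    then have "p = map_option q"
      by (auto simp: fun_eq_iff map_option_case q split: option.split)
    ultimately show False using p bij_imp_permutes[of q UNIV] by auto
  qed
  have inj: "inj_on map_option {q. q permutes (UNIV :: 'm set)}"
    by (auto intro!: inj_onI ext) (metis option.inject option.map(2))
  have "det N = sum ?f {p. p permutes UNIV}" by (simp add: det_def)
  also have "\<dots> = sum ?f ?T"
    by (rule sum.mono_neutral_right) (use zero map_option_permutes in auto)
  also have "\<dots> = (\<Sum>q | q permutes UNIV. ?f (map_option q))"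
    by (simp add: sum.reindex[OF inj])
  also have "\<dots> = (\<Sum>q | q permutes UNIV. N $ None $ None * (of_int (sign q) * (\<Prod>i\<in>UNIV. N $ Some i $ Some (q i))))"
    by (rule sum.cong) (auto simp: sign_map_option prod_UNIV_option mult_ac)
  also have "\<dots> = N $ None $ None * det (\<chi> i j. N $ Some i $ Some j)"
    by (simp add: det_def sum_distrib_left)
  finally show ?thesis .
qed

lemma mult_homog:
  "(A *v homog x) $ i = (\<Sum>j\<in>UNIV. A $ i $ Some j * x $ j) + A $ i $ None"
  by (simp add: matrix_vector_mult_def sum_UNIV_option homog_def add.commute)

lemma homog_Some [simp]: "homog p $ Some i = p $ i" and homog_None [simp]: "homog p $ None = 1"
  by (simp_all add: homog_def)

text \<open>Up to a positive factor, the derivative at \<open>p\<close> of the projective map \<open>A\<close>, where \<open>A\<close> sends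
  \<open>p\<close> to \<open>q\<close>.\<close>

definition projective_deriv :: "real ^ 'm::finite option ^ 'm option \<Rightarrow> real ^ 'm \<Rightarrow> real ^ 'm ^ 'm" where
  "projective_deriv A q = (\<chi> i j. A $ Some i $ Some j - q $ i * A $ None $ Some j)"

text \<open>Translations have determinant 1 in homogeneous coordinates. Composing \<open>A\<close>
  with those taking 0 to \<open>p\<close> and \<open>q\<close> to 0 makes column \<open>None\<close>
  equal to (0, ..., 0, c) and leaves the derivative as the remaining block.\<close>

lemma det_projective_deriv:
  fixes A :: "real ^ 'm::finite option ^ 'm option"
  assumes A: "A *v homog p = c *\<^sub>R homog q"
  shows "det A = c * det (projective_deriv A q)"
proof -
  \<comment> \<open>\<open>E v\<close> is the homogeneous matrix of the translation by
    \<open>v\<close>.\<close>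
  define E :: "real ^ 'm \<Rightarrow> real ^ 'm option ^ 'm option" where
    "E v = (\<chi> i j. case j of None \<Rightarrow> (case i of None \<Rightarrow> 1 | Some i' \<Rightarrow> v $ i') | Some j' \<Rightarrow> of_bool (i = Some j'))" for v
  have E: "E v $ i $ None = (case i of None \<Rightarrow> 1 | Some i' \<Rightarrow> v $ i')"
    "E v $ i $ Some j = of_bool (i = Some j)" for v i j
    by (simp_all add: E_def)
  have detE: "det (E v) = 1" for v
  proof -
    have "det (E v) = det (transpose (E v))" by simp
    also have "\<dots> = det (\<chi> i j. transpose (E v) $ Some i $ Some j)"
      by (subst det_option_block) (auto simp: transpose_def E)
    also have "(\<chi> i j. transpose (E v) $ Some i $ Some j) = mat 1"
      by (auto simp: vec_eq_iff transpose_def E mat_def)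
    finally show ?thesis by simp
  qed
  define N where "N = E (- q) ** (A ** E p)"
  have AE: "(A ** E p) $ i $ None = (A *v homog p) $ i" "(A ** E p) $ i $ Some j = A $ i $ Some j" for i j
    by (auto simp: matrix_matrix_mult_def sum_UNIV_option E mult_homog add.commute)
  have N_Some: "N $ Some i $ j = (A ** E p) $ Some i $ j - q $ i * (A ** E p) $ None $ j" for i j
    by (simp add: N_def matrix_matrix_mult_def[of "E (- q)"] sum_UNIV_option E)
  have N_None: "N $ None $ None = c"
    by (simp add: N_def matrix_matrix_mult_def[of "E (- q)"] sum_UNIV_option E AE A)
  have "det A = det N"
    by (simp add: N_def det_mul detE)
  also have "\<dots> = N $ None $ None * det (\<chi> i j. N $ Some i $ Some j)"
    by (rule det_option_block) (simp add: N_Some AE A)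
  also have "(\<chi> i j. N $ Some i $ Some j) = projective_deriv A q"
    by (simp add: vec_eq_iff N_Some AE projective_deriv_def)
  finally show ?thesis by (simp add: N_None)
qed

text \<open>Subtracting q times the \<open>None\<close> entry from the \<open>Some\<close> entries
  is a linear map that kills \<open>homog q\<close> and sends \<open>homog y\<close> to
  \<open>y - q\<close>. Hence the identity is exact at every distance from \<open>p\<close>, with no
  limit involved.\<close>

lemma projective_deriv_mult:
  assumes p: "A *v homog p = c *\<^sub>R homog q" and x: "A *v homog x = d *\<^sub>R homog y"
  shows "projective_deriv A q *v (x - p) = d *\<^sub>R (y - q)"
proof (rule vec_eq_iff[THEN iffD2, OF allI])
  fix i
  have "(projective_deriv A q *v (x - p)) $ i =
      ((A *v homog x) $ Some i - q $ i * (A *v homog x) $ None) -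
      ((A *v homog p) $ Some i - q $ i * (A *v homog p) $ None)"
    by (simp add: mult_homog) (simp add: projective_deriv_def matrix_vector_mult_def algebra_simps sum.distrib sum_subtractf sum_distrib_left)
  then show "(projective_deriv A q *v (x - p)) $ i = (d *\<^sub>R (y - q)) $ i"
    by (simp add: p x algebra_simps)
qed

subsection \<open>Orientation-preserving homeomorphisms of the cube\<close>

text \<open>This is invariance of domain, applied to the injective continuous map
  \<open>S\<close>.\<close>

lemma homeomorphism_unit_cube_interior:
  fixes S :: "real ^ 'm::finite \<Rightarrow> real ^ 'm"
  assumes "homeomorphism unit_cube unit_cube S T" "p \<in> interior unit_cube"
  shows "S p \<in> interior unit_cube"
proof -
  have "S ` interior unit_cube \<subseteq> interior (S ` unit_cube)"
    using assms(1) by (intro continuous_image_subset_interior)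
      (auto simp: homeomorphism_def intro: inj_on_inverseI)
  then show ?thesis
    using assms by (auto simp: homeomorphism_def)
qed

lemma homeomorphism_unit_cube_frontier:
  fixes S :: "real ^ 'm::finite \<Rightarrow> real ^ 'm"
  assumes S: "homeomorphism unit_cube unit_cube S T" and p: "p \<in> frontier unit_cube"
  shows "S p \<in> frontier unit_cube"
proof -
  have p': "p \<in> unit_cube" "p \<notin> interior unit_cube"
    using p frontier_subset_closed[OF closed_cbox] by (auto simp: frontier_def)
  have Sp: "S p \<in> unit_cube" and T: "T (S p) = p"
    using S p' by (auto simp: homeomorphism_def)
  have "S p \<notin> interior unit_cube"
    using homeomorphism_unit_cube_interior[OF homeomorphism_symD[OF S]] T p' by metis
  with Sp show ?thesis
    unfolding frontier_def using closure_closed[OF closed_cbox] by blast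
qed

text \<open>The cube is contractible, so the boundary map of the pair is an isomorphism onto the
  reduced homology of the frontier; by naturality the trivial action of \<open>S\<close> carries
  over.\<close>

lemma orientation_preserving_frontier_homology:
  fixes S :: "real ^ 'm::finite \<Rightarrow> real ^ 'm"
  assumes S: "homeomorphism unit_cube unit_cube S T" and op: "orientation_preserving S"
    and c: "c \<in> carrier (reduced_homology_group (int CARD('m) - 1) (top_of_set (frontier (unit_cube :: (real ^ 'm) set))))"
  shows "hom_induced (int CARD('m) - 1) (top_of_set (frontier unit_cube)) {} (top_of_set (frontier unit_cube)) {} S c = c"
proof -
  let ?D = "top_of_set (unit_cube :: (real ^ 'm) set)" and ?F = "frontier (unit_cube :: (real ^ 'm) set)"
  let ?m = "int CARD('m)"
  have FD: "?F \<subseteq> unit_cube" by (rule frontier_subset_closed[OF closed_cbox])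
  have sub: "subtopology ?D ?F = top_of_set ?F"
    using FD by (simp add: subtopology_subtopology Int_absorb1)
  have "?F \<noteq> {}"
  proof -
    have "(0 :: real ^ 'm) \<in> unit_cube" by (simp add: mem_box_cart)
    moreover have "unit_cube \<noteq> (UNIV :: (real ^ 'm) set)" using not_bounded_UNIV bounded_cbox by metis
    ultimately show ?thesis by (auto simp: frontier_eq_empty)
  qed
  then have "hom_boundary ?m ?D ?F \<in> iso (relative_homology_group ?m ?D ?F) (reduced_homology_group (?m - 1) (subtopology ?D ?F))"
    using FD by (intro iso_relative_homology_of_contractible)
      (auto simp: contractible_space_top_of_set convex_imp_contractible)
  then have "carrier (reduced_homology_group (?m - 1) (subtopology ?D ?F)) =
      hom_boundary ?m ?D ?F ` carrier (relative_homology_group ?m ?D ?F)"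
    by (auto simp: iso_def bij_betw_def)
  then obtain d where d: "d \<in> carrier (relative_homology_group ?m ?D ?F)" "c = hom_boundary ?m ?D ?F d"
    using c unfolding sub by auto
  have "continuous_map ?D ?D S" "S \<in> ?F \<rightarrow> ?F"
    using S homeomorphism_unit_cube_frontier[OF S] by (auto simp: homeomorphism_def)
  from fun_cong[OF naturality_hom_induced[OF this, of ?m], of d]
  have "hom_induced (?m - 1) (top_of_set ?F) {} (top_of_set ?F) {} S c =
      hom_boundary ?m ?D ?F (hom_induced ?m ?D ?F ?D ?F S d)"
    by (simp add: sub d(2))
  also have "hom_induced ?m ?D ?F ?D ?F S d = d"
    using op d(1) by (simp add: orientation_preserving_def)
  finally show ?thesis by (simp add: d(2))
qed

text \<open>The degree of \<open>S\<close> on the boundary is compared with its degree on a small sphere around \<open>p\<close>,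
  where \<open>S\<close> agrees with its derivative up to positive factors.\<close>

lemma orientation_preserving_imp_det_nonneg:
  fixes S :: "real ^ 'm::finite \<Rightarrow> real ^ 'm"
  assumes S: "homeomorphism unit_cube unit_cube S T" and op: "orientation_preserving S"
    and p: "p \<in> interior C" and C: "C \<subseteq> unit_cube"
    and A: "\<And>x. x \<in> C \<Longrightarrow> \<exists>c>0. A *v homog x = c *\<^sub>R homog (S x)"
  shows "det A \<ge> 0"
proof (rule ccontr)
  assume "\<not> det A \<ge> 0"
  let ?D = "unit_cube :: (real ^ 'm) set" and ?F = "frontier (unit_cube :: (real ^ 'm) set)"
  let ?Z = "top_of_set (- {0 :: real ^ 'm})" and ?k = "int CARD('m) - 1"
  define q where "q = S p"
  define M where "M = projective_deriv A q"
  have pD: "p \<in> interior ?D" using p C interior_mono by blast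
  have pC: "p \<in> C" using p interior_subset by blast
  have qD: "q \<in> interior ?D"
    unfolding q_def by (rule homeomorphism_unit_cube_interior[OF S pD])
  obtain cp where cp: "cp > 0" "A *v homog p = cp *\<^sub>R homog q"
    using A[OF pC] by (auto simp: q_def)
  have detM: "det M < 0"
    using \<open>\<not> det A \<ge> 0\<close> det_projective_deriv[OF cp(2)] cp(1)
    by (simp add: M_def zero_le_mult_iff)
  have contS: "continuous_on ?D S" and injS: "inj_on S ?D" and SD: "S ` ?D = ?D"
    using S by (auto simp: homeomorphism_def intro: inj_on_inverseI)
  have FD: "?F \<subseteq> ?D" by (rule frontier_subset_closed[OF closed_cbox])
  obtain \<epsilon> where \<epsilon>: "\<epsilon> > 0" "cball p \<epsilon> \<subseteq> C"
    using p by (meson mem_interior_cball)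
  \<comment> \<open>\<open>e\<close> puts the direction of \<open>x\<close> on the sphere of radius
    \<open>\<epsilon>\<close> around \<open>p\<close>, which lies in \<open>C\<close>, where
    \<open>A\<close> describes \<open>S\<close>.\<close>
  define e where "e x = p + (\<epsilon> / norm x) *\<^sub>R x" for x :: "real ^ 'm"
  have eC: "e x \<in> C" and ep: "e x \<noteq> p" if "x \<noteq> 0" for x
  proof -
    have "e x \<in> cball p \<epsilon>" using that \<epsilon>(1) by (simp add: e_def dist_norm)
    then show "e x \<in> C" using \<epsilon>(2) by blast
    show "e x \<noteq> p" using that \<epsilon>(1) by (simp add: e_def)
  qed
  have ce: "continuous_map ?Z (top_of_set (?D - {p})) e"
  proof -
    have "continuous_on (- {0}) e" unfolding e_def by (intro continuous_intros) auto
    then show ?thesis using eC ep C by auto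
  qed
  have rel: "rel_frontier ?D = ?F" "rel_interior ?D = interior ?D"
    using pD rel_interior_nonempty_interior[of ?D] by (auto simp: rel_frontier_def frontier_def)
  \<comment> \<open>\<open>r\<close> pushes the punctured cube onto its frontier and is homotopic to
    the identity. So \<open>\<rho>\<close>, with values in the frontier, is homotopic to
    \<open>e\<close> without meeting \<open>p\<close>.\<close>
  obtain r where r: "homotopic_with_canon (\<lambda>x. True) (?D - {p}) (?D - {p}) id r"
    and rr: "retraction (?D - {p}) ?F r"
    using rel_frontier_deformation_retract_of_punctured_convex[of ?D ?D p] pD FD
    by (auto simp: rel hull_subset)
  have cr: "continuous_map (top_of_set (?D - {p})) (top_of_set ?F) r"
    using rr by (auto simp: retraction_def)
  define \<rho> where "\<rho> = r \<circ> e"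
  have c\<rho>: "continuous_map ?Z (top_of_set ?F) \<rho>"
    unfolding \<rho>_def by (rule continuous_map_compose[OF ce cr])
  have hom_e: "homotopic_with (\<lambda>_. True) ?Z (top_of_set (?D - {p})) e \<rho>"
    using homotopic_with_compose_continuous_map_right[OF r ce, of "\<lambda>_. True"] by (simp add: \<rho>_def)
  have \<rho>F: "\<rho> x \<in> ?F" if "x \<noteq> 0" for x
    using c\<rho> that by (auto simp: continuous_map_def)

  \<comment> \<open>The vectors \<open>S (e x) - q\<close> and \<open>M *v x\<close> are positive
    multiples of each other, so the segment between them misses 0.\<close>
  have "homotopic_with (\<lambda>_. True) ?Z ?Z ((\<lambda>x. S x - q) \<circ> e) ((*v) M)"
  proof (rule homotopic_with_linear)
    show "continuous_on (- {0}) ((\<lambda>x. S x - q) \<circ> e)"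
    proof (rule continuous_on_compose)
      show "continuous_on (- {0}) e" using ce by simp
      have "e ` (- {0}) \<subseteq> ?D" using eC C by auto
      then show "continuous_on (e ` (- {0})) (\<lambda>x. S x - q)"
        by (intro continuous_on_diff continuous_on_const continuous_on_subset[OF contS])
    qed
    fix x :: "real ^ 'm" assume "x \<in> - {0}"
    then have x: "x \<noteq> 0" by simp
    obtain d where d: "d > 0" "A *v homog (e x) = d *\<^sub>R homog (S (e x))"
      using A[OF eC[OF x]] by auto
    have "M *v (e x - p) = d *\<^sub>R (S (e x) - q)"
      unfolding M_def by (rule projective_deriv_mult[OF cp(2) d(2)])
    then have "(\<epsilon> / norm x) *\<^sub>R (M *v x) = d *\<^sub>R (S (e x) - q)"
      by (simp add: e_def matrix_vector_mult_scaleR)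
    then have "(1 / d) *\<^sub>R ((\<epsilon> / norm x) *\<^sub>R (M *v x)) = S (e x) - q"
      using d(1) by simp
    then have eq: "S (e x) - q = (\<epsilon> / norm x / d) *\<^sub>R (M *v x)" by (simp add: mult.commute)
    have Mx: "M *v x \<noteq> 0"
    proof
      assume "M *v x = 0"
      moreover have "inj ((*v) M)" using detM by (simp flip: det_nz_iff_inj)
      ultimately show False using x injD[of "(*v) M" x 0] by simp
    qed
    have "(1 - t) * (\<epsilon> / norm x / d) + t > 0" if "0 \<le> t" "t \<le> 1" for t
    proof (cases "t = 0")
      case False
      have "(1 - t) * (\<epsilon> / norm x / d) \<ge> 0"
        using \<epsilon>(1) d(1) that by (intro mult_nonneg_nonneg divide_nonneg_nonneg) auto
      with False that show ?thesis by linarith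
    qed (use x \<epsilon>(1) d(1) in simp)
    then have "((1 - t) * (\<epsilon> / norm x / d) + t) *\<^sub>R (M *v x) \<noteq> 0" if "0 \<le> t" "t \<le> 1" for t
      using Mx that by (metis less_irrefl scaleR_eq_0_iff)
    then show "closed_segment (((\<lambda>x. S x - q) \<circ> e) x) (M *v x) \<subseteq> - {0}"
      by (auto simp: eq closed_segment_def scaleR_add_left)
  qed (rule matrix_vector_mult_linear_continuous_on)
  \<comment> \<open>Moving from the small sphere to the frontier stays inside the punctured cube,
    where injectivity keeps \<open>S\<close> away from \<open>q\<close>.\<close>
  moreover have "homotopic_with (\<lambda>_. True) ?Z ?Z ((\<lambda>x. S x - q) \<circ> e) ((\<lambda>x. S x - q) \<circ> \<rho>)"
  proof (rule homotopic_with_compose_continuous_map_left[OF hom_e])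
    show "continuous_map (top_of_set (?D - {p})) ?Z (\<lambda>x. S x - q)"
    proof -
      have "continuous_on (?D - {p}) (\<lambda>x. S x - q)"
        by (intro continuous_on_diff continuous_on_const continuous_on_subset[OF contS]) auto
      moreover have "S x \<noteq> q" if "x \<in> ?D - {p}" for x
        using injS pC C that by (auto simp: q_def inj_on_def)
      ultimately show ?thesis by auto
    qed
  qed simp
  ultimately have h1: "hom_induced ?k ?Z {} ?Z {} ((*v) M) = hom_induced ?k ?Z {} ?Z {} ((\<lambda>x. S x - q) \<circ> \<rho>)"
    by (metis homology_homotopy_empty)

  \<comment> \<open>The center can move from \<open>q\<close> to \<open>p\<close>: by convexity the
    segment between them stays in the interior, whereas \<open>\<rho> x\<close> lies on the
    frontier.\<close>
  have "homotopic_with (\<lambda>_. True) ?Z ?Z ((\<lambda>x. x - q) \<circ> \<rho>) ((\<lambda>x. x - p) \<circ> \<rho>)"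
  proof (rule homotopic_with_linear)
    have "continuous_on (- {0}) \<rho>" using c\<rho> by simp
    then show "continuous_on (- {0}) ((\<lambda>x. x - q) \<circ> \<rho>)" "continuous_on (- {0}) ((\<lambda>x. x - p) \<circ> \<rho>)"
      unfolding o_def by (intro continuous_on_diff continuous_on_const; assumption)+
    fix x :: "real ^ 'm" assume "x \<in> - {0}"
    then have "\<rho> x \<notin> interior ?D" using \<rho>F[of x] by (auto simp: frontier_def)
    then have "(1 - t) *\<^sub>R (\<rho> x - q) + t *\<^sub>R (\<rho> x - p) \<noteq> 0" if "0 \<le> t" "t \<le> 1" for t
    proof -
      have "(1 - t) *\<^sub>R q + t *\<^sub>R p \<in> interior ?D"
        using convexD[OF convex_interior[OF convex_box(1)] qD pD, of "1 - t" t] that by simp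
      then have "\<rho> x \<noteq> (1 - t) *\<^sub>R q + t *\<^sub>R p" using \<open>\<rho> x \<notin> interior ?D\<close> by metis
      moreover have "(1 - t) *\<^sub>R (\<rho> x - q) + t *\<^sub>R (\<rho> x - p) = \<rho> x - ((1 - t) *\<^sub>R q + t *\<^sub>R p)"
        by (simp add: algebra_simps)
      ultimately show ?thesis by simp
    qed
    then show "closed_segment (((\<lambda>x. x - q) \<circ> \<rho>) x) (((\<lambda>x. x - p) \<circ> \<rho>) x) \<subseteq> - {0}"
      by (auto simp: closed_segment_def)
  qed
  moreover have "homotopic_with (\<lambda>_. True) ?Z ?Z ((\<lambda>x. x - p) \<circ> e) ((\<lambda>x. x - p) \<circ> \<rho>)"
    by (rule homotopic_with_compose_continuous_map_left[OF hom_e]) (auto intro: continuous_on_diff continuous_on_id continuous_on_const)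
  moreover have "homotopic_with (\<lambda>_. True) ?Z ?Z ((\<lambda>x. x - p) \<circ> e) id"
  proof (rule homotopic_with_linear)
    show "continuous_on (- {0}) ((\<lambda>x. x - p) \<circ> e)"
      unfolding o_def e_def by (intro continuous_intros) auto
    fix x :: "real ^ 'm" assume "x \<in> - {0}"
    then have x: "x \<noteq> 0" by simp
    have "(1 - t) * (\<epsilon> / norm x) + t > 0" if "0 \<le> t" "t \<le> 1" for t
    proof (cases "t = 0")
      case False
      have "(1 - t) * (\<epsilon> / norm x) \<ge> 0"
        using \<epsilon>(1) that by (intro mult_nonneg_nonneg divide_nonneg_nonneg) auto
      with False that show ?thesis by linarith
    qed (use x \<epsilon>(1) in simp)
    then have "((1 - t) * (\<epsilon> / norm x) + t) *\<^sub>R x \<noteq> 0" if "0 \<le> t" "t \<le> 1" for t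
      using x that by (metis less_irrefl scaleR_eq_0_iff)
    then show "closed_segment (((\<lambda>x. x - p) \<circ> e) x) (id x) \<subseteq> - {0}"
      by (auto simp: e_def closed_segment_def scaleR_add_left)
  qed auto
  ultimately have h2: "hom_induced ?k ?Z {} ?Z {} ((\<lambda>x. x - q) \<circ> \<rho>) = hom_induced ?k ?Z {} ?Z {} id"
    by (metis homology_homotopy_empty)

  have cS: "continuous_map (top_of_set ?F) (top_of_set ?F) S"
    using homeomorphism_unit_cube_frontier[OF S] continuous_on_subset[OF contS FD] by auto
  have cq: "continuous_map (top_of_set ?F) ?Z (\<lambda>x. x - q)"
    using qD by (auto simp: frontier_def intro: continuous_on_diff continuous_on_id continuous_on_const)
  \<comment> \<open>The action of \<open>M\<close> factors through the frontier, where
    \<open>S\<close> acts trivially; once \<open>S\<close> is dropped, the composite is the identity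
    by \<open>h2\<close>.\<close>
  have "hom_induced ?k ?Z {} ?Z {} ((*v) M) c = c"
    if c: "c \<in> carrier (reduced_homology_group ?k ?Z)" for c
  proof -
    let ?d = "hom_induced ?k ?Z {} (top_of_set ?F) {} \<rho> c"
    have d: "?d \<in> carrier (reduced_homology_group ?k (top_of_set ?F))"
      by (rule hom_induced_reduced[OF c])
    have "(\<lambda>x. S x - q) \<circ> \<rho> = (\<lambda>x. x - q) \<circ> (S \<circ> \<rho>)" by auto
    then have "hom_induced ?k ?Z {} ?Z {} ((*v) M) c =
        hom_induced ?k (top_of_set ?F) {} ?Z {} (\<lambda>x. x - q) (hom_induced ?k (top_of_set ?F) {} (top_of_set ?F) {} S ?d)"
      by (simp add: h1 hom_induced_compose_empty[OF continuous_map_compose[OF c\<rho> cS] cq]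
          hom_induced_compose_empty[OF c\<rho> cS])
    also have "\<dots> = hom_induced ?k ?Z {} ?Z {} ((\<lambda>x. x - q) \<circ> \<rho>) c"
      by (simp add: orientation_preserving_frontier_homology[OF S op d] hom_induced_compose_empty[OF c\<rho> cq])
    also have "\<dots> = c"
      unfolding h2 by (rule hom_induced_id[OF subsetD[OF carrier_reduced_homology_group_subset c]])
    finally show ?thesis .
  qed
  moreover have "continuous_map ?Z ?Z ((*v) M)"
    using punctured_degree_matrix[of M] detM by (auto simp: punctured_degree_def)
  ultimately have "punctured_degree ((*v) M) 1"
    by (simp add: punctured_degree_def group.int_pow_1)
  with not_punctured_degree_1_if_det_neg[OF detM] show False by simp
qed

subsection \<open>Homomorphisms of the positive cone to the reals\<close>

definition int_affine :: "(int ^ 'm::finite) \<times> int \<Rightarrow> real ^ 'm \<Rightarrow> real" where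
  "int_affine l p = (\<Sum>i\<in>UNIV. of_int (fst l $ i) * p $ i) + of_int (snd l)"

lemma int_affine_add: "int_affine (l + l') p = int_affine l p + int_affine l' p"
  by (simp add: int_affine_def algebra_simps sum.distrib)

lemma int_affine_diff: "int_affine (l - l') p = int_affine l p - int_affine l' p"
  by (simp add: int_affine_def algebra_simps sum_subtractf)

lemma int_affine_0 [simp]: "int_affine 0 p = 0"
  by (simp add: int_affine_def)

lemma int_affine_const [simp]: "int_affine (0, b) p = of_int b"
  by (simp add: int_affine_def)

lemma int_affine_axis: "int_affine (axis i 1, b) p = p $ i + of_int b"
proof -
  have "(\<Sum>j\<in>UNIV. of_int (axis i (1 :: int) $ j) * p $ j) = (\<Sum>j\<in>UNIV. if j = i then p $ j else 0)"
    by (rule sum.cong) (auto simp: axis_def)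
  then show ?thesis by (simp add: int_affine_def)
qed

lemma continuous_on_int_affine [continuous_intros]: "continuous_on X (int_affine l)"
  unfolding int_affine_def by (intro continuous_intros)

lemma mcnaughton_iff:
  "f \<in> mcnaughton \<longleftrightarrow> f \<in> extensional unit_cube \<and> continuous_on unit_cube f \<and>
     (\<exists>L. finite L \<and> (\<forall>p\<in>unit_cube. \<exists>l\<in>L. f p = int_affine l p))"
  by (auto simp: mcnaughton_def int_affine_def split_beta)

lemma mcnaughtonI:
  assumes "f \<in> extensional unit_cube" "continuous_on unit_cube f" "finite L"
    "\<And>p. p \<in> unit_cube \<Longrightarrow> \<exists>l\<in>L. f p = int_affine l p"
  shows "f \<in> mcnaughton"
  using assms by (auto simp: mcnaughton_iff)

lemma G_pos_iff: "f \<in> carrier G_pos \<longleftrightarrow> f \<in> mcnaughton \<and> (\<forall>p\<in>unit_cube. 0 \<le> f p)"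
  by (simp add: G_pos_def)

lemma hoop_plus_G_pos: "p \<in> unit_cube \<Longrightarrow> hoop_plus G_pos f g p = f p + g p"
  and hoop_monus_G_pos: "p \<in> unit_cube \<Longrightarrow> hoop_monus G_pos f g p = max 0 (f p - g p)"
  and hoop_zero_G_pos: "p \<in> unit_cube \<Longrightarrow> hoop_zero G_pos p = 0"
  by (simp_all add: G_pos_def)

lemma one_fun_apply [simp]: "p \<in> unit_cube \<Longrightarrow> one_fun p = 1"
  and proj_fun_apply [simp]: "p \<in> unit_cube \<Longrightarrow> proj_fun i p = p $ i"
  by (simp_all add: one_fun_def proj_fun_def)

lemma G_pos_eqI:
  assumes "f \<in> carrier G_pos" "g \<in> carrier G_pos" "\<And>p. p \<in> unit_cube \<Longrightarrow> f p = g p"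
  shows "f = g"
  using assms by (auto simp: G_pos_iff mcnaughton_iff intro: extensionalityI)

lemma continuous_on_cong_unit_cube:
  assumes "continuous_on unit_cube g" "\<And>p. p \<in> unit_cube \<Longrightarrow> f p = g p"
  shows "continuous_on unit_cube f"
  using continuous_on_cong[OF refl, of unit_cube f g] assms by blast

lemma one_fun_in_G_pos [simp]: "(one_fun :: real ^ 'm::finite \<Rightarrow> real) \<in> carrier G_pos"
  unfolding G_pos_iff
proof (intro conjI ballI mcnaughtonI[where L = "{(0, 1)}"])
  show "continuous_on unit_cube (one_fun :: real ^ 'm \<Rightarrow> real)"
    by (rule continuous_on_cong_unit_cube[OF continuous_on_const[of _ 1]]) simp
qed (auto simp: one_fun_def)

lemma proj_fun_in_G_pos [simp]: "proj_fun i \<in> carrier G_pos"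
  unfolding G_pos_iff
proof (intro conjI ballI mcnaughtonI[where L = "{(axis i 1, 0)}"])
  show "continuous_on unit_cube (proj_fun i)"
    by (rule continuous_on_cong_unit_cube[of "\<lambda>p. p $ i"]) (auto intro: continuous_intros)
qed (auto simp: int_affine_axis mem_box_cart proj_fun_def)

lemma hoop_zero_in_G_pos [simp]: "(hoop_zero G_pos :: real ^ 'm::finite \<Rightarrow> real) \<in> carrier G_pos"
  unfolding G_pos_iff
proof (intro conjI ballI mcnaughtonI[where L = "{0}"])
  show "continuous_on unit_cube (hoop_zero G_pos :: real ^ 'm \<Rightarrow> real)"
    by (rule continuous_on_cong_unit_cube[OF continuous_on_const[of _ 0]]) (simp add: hoop_zero_G_pos)
qed (auto simp: G_pos_def)

lemma hoop_plus_in_G_pos [simp]: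
  assumes "f \<in> carrier G_pos" "g \<in> carrier G_pos"
  shows "hoop_plus G_pos f g \<in> carrier G_pos"
proof -
  obtain L M where L: "finite L" "\<forall>p\<in>unit_cube. \<exists>l\<in>L. f p = int_affine l p"
    and M: "finite M" "\<forall>p\<in>unit_cube. \<exists>l\<in>M. g p = int_affine l p"
    using assms by (auto simp: G_pos_iff mcnaughton_iff)
  have "hoop_plus G_pos f g \<in> mcnaughton"
  proof (rule mcnaughtonI[where L = "(\<lambda>(l, l'). l + l') ` (L \<times> M)"])
    show "continuous_on unit_cube (hoop_plus G_pos f g)"
      by (rule continuous_on_cong_unit_cube[of "\<lambda>p. f p + g p"])
        (use assms in \<open>auto simp: hoop_plus_G_pos G_pos_iff mcnaughton_iff intro: continuous_intros\<close>)
    fix p :: "real ^ 'a" assume p: "p \<in> unit_cube"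
    obtain l l' where "l \<in> L" "f p = int_affine l p" "l' \<in> M" "g p = int_affine l' p"
      using L M p by blast
    then show "\<exists>l\<in>(\<lambda>(l, l'). l + l') ` (L \<times> M). hoop_plus G_pos f g p = int_affine l p"
      using p by (intro bexI[of _ "l + l'"]) (auto simp: hoop_plus_G_pos int_affine_add)
  qed (use L M in \<open>auto simp: G_pos_def\<close>)
  then show ?thesis using assms by (auto simp: G_pos_iff hoop_plus_G_pos)
qed

lemma hoop_monus_in_G_pos [simp]:
  assumes "f \<in> carrier G_pos" "g \<in> carrier G_pos"
  shows "hoop_monus G_pos f g \<in> carrier G_pos"
proof -
  obtain L M where L: "finite L" "\<forall>p\<in>unit_cube. \<exists>l\<in>L. f p = int_affine l p"
    and M: "finite M" "\<forall>p\<in>unit_cube. \<exists>l\<in>M. g p = int_affine l p"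
    using assms by (auto simp: G_pos_iff mcnaughton_iff)
  have "hoop_monus G_pos f g \<in> mcnaughton"
  proof (rule mcnaughtonI[where L = "insert 0 ((\<lambda>(l, l'). l - l') ` (L \<times> M))"])
    show "continuous_on unit_cube (hoop_monus G_pos f g)"
      by (rule continuous_on_cong_unit_cube[of "\<lambda>p. max 0 (f p - g p)"])
        (use assms in \<open>auto simp: hoop_monus_G_pos G_pos_iff mcnaughton_iff intro: continuous_intros\<close>)
    fix p :: "real ^ 'a" assume p: "p \<in> unit_cube"
    obtain l l' where "l \<in> L" "f p = int_affine l p" "l' \<in> M" "g p = int_affine l' p"
      using L M p by blast
    then show "\<exists>l\<in>insert 0 ((\<lambda>(l, l'). l - l') ` (L \<times> M)). hoop_monus G_pos f g p = int_affine l p"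
      using p by (intro bexI[of _ "if f p \<le> g p then 0 else l - l'"])
        (auto simp: hoop_monus_G_pos int_affine_diff)
  qed (use L M in \<open>auto simp: G_pos_def\<close>)
  then show ?thesis using assms by (auto simp: G_pos_iff hoop_monus_G_pos)
qed

lemma G_pos_bounded:
  assumes "f \<in> carrier G_pos"
  obtains n :: nat where "\<And>p. p \<in> unit_cube \<Longrightarrow> f p \<le> real n"
proof -
  have "compact (f ` unit_cube)"
    using assms by (intro compact_continuous_image) (auto simp: G_pos_iff mcnaughton_iff)
  then obtain b where "\<And>p. p \<in> unit_cube \<Longrightarrow> norm (f p) \<le> b"
    by (meson bounded_iff compact_imp_bounded imageI)
  moreover obtain n where "b \<le> real n" using real_arch_simple by blast
  ultimately show ?thesis using that[of n] by (force simp: abs_le_iff)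
qed

text \<open>Iterated \<open>hoop_plus\<close>, because homomorphisms are only known to respect the
  hoop operations.\<close>

definition nat_multiple :: "nat \<Rightarrow> (real ^ 'm::finite \<Rightarrow> real) \<Rightarrow> real ^ 'm \<Rightarrow> real" where
  "nat_multiple n f = (hoop_plus G_pos f ^^ n) (hoop_zero G_pos)"

lemma nat_multiple_in_G_pos [simp]: "f \<in> carrier G_pos \<Longrightarrow> nat_multiple n f \<in> carrier G_pos"
  by (induction n) (auto simp: nat_multiple_def)

lemma nat_multiple_apply: "p \<in> unit_cube \<Longrightarrow> nat_multiple n f p = real n * f p"
  by (induction n) (auto simp: nat_multiple_def hoop_plus_G_pos hoop_zero_G_pos algebra_simps)

text \<open>By compactness of the cube, the zero sets of the functions killed by \<open>\<phi>\<close> have a common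
  point \<open>q\<close>; comparing with rational multiples of the unit then determines \<open>\<phi>\<close>.\<close>

lemma hoop_hom_to_real_is_evaluation:
  fixes \<phi> :: "(real ^ 'm::finite \<Rightarrow> real) \<Rightarrow> real"
  assumes add: "\<And>f g. f \<in> carrier G_pos \<Longrightarrow> g \<in> carrier G_pos \<Longrightarrow> \<phi> (hoop_plus G_pos f g) = \<phi> f + \<phi> g"
    and monus: "\<And>f g. f \<in> carrier G_pos \<Longrightarrow> g \<in> carrier G_pos \<Longrightarrow> \<phi> (hoop_monus G_pos f g) = max 0 (\<phi> f - \<phi> g)"
    and nonneg: "\<And>f. f \<in> carrier G_pos \<Longrightarrow> \<phi> f \<ge> 0"
    and nontriv: "f\<^sub>0 \<in> carrier G_pos" "\<phi> f\<^sub>0 \<noteq> 0"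
  obtains q where "q \<in> unit_cube" "\<phi> one_fun > 0" "\<And>f. f \<in> carrier G_pos \<Longrightarrow> \<phi> f = \<phi> one_fun * f q"
proof -
  let ?G = "carrier G_pos :: (real ^ 'm \<Rightarrow> real) set"
  define c where "c = \<phi> one_fun"
  have zero: "\<phi> (hoop_zero G_pos) = 0"
  proof -
    have "hoop_plus G_pos (hoop_zero G_pos) (hoop_zero G_pos) = (hoop_zero G_pos :: real ^ 'm \<Rightarrow> real)"
      by (rule G_pos_eqI) (auto simp: hoop_plus_G_pos hoop_zero_G_pos)
    then show ?thesis using add[of "hoop_zero G_pos" "hoop_zero G_pos"] by simp
  qed
  \<comment> \<open>The order is definable in the hoop: f is below g exactly when the truncated
    difference of f and g vanishes.\<close>
  have mono: "\<phi> f \<le> \<phi> g" if "f \<in> ?G" "g \<in> ?G" "\<And>p. p \<in> unit_cube \<Longrightarrow> f p \<le> g p" for f g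
  proof -
    have "hoop_monus G_pos f g = hoop_zero G_pos"
      using that(1,2) by (intro G_pos_eqI) (auto simp: hoop_monus_G_pos hoop_zero_G_pos max_absorb1 that(3))
    with monus[OF that(1,2)] zero show ?thesis by simp
  qed
  have mult: "\<phi> (nat_multiple n f) = real n * \<phi> f" if "f \<in> ?G" for n f
  proof (induction n)
    case (Suc n)
    have "nat_multiple (Suc n) f = hoop_plus G_pos f (nat_multiple n f)" by (simp add: nat_multiple_def)
    then show ?case using add[OF that, of "nat_multiple n f"] that Suc by (simp add: algebra_simps)
  qed (simp add: nat_multiple_def zero)
  have bound: "\<phi> f \<le> real n * c" if "f \<in> ?G" "\<And>p. p \<in> unit_cube \<Longrightarrow> f p \<le> real n" for f n
    using mono[of f "nat_multiple n one_fun"] mult[of one_fun n] that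
    by (simp add: nat_multiple_apply c_def)
  \<comment> \<open>If \<open>c\<close> were 0, \<open>bound\<close> would annihilate every element
    of the cone, in particular \<open>f\<^sub>0\<close>.\<close>
  have c: "c > 0"
  proof -
    obtain n where "\<And>p. p \<in> unit_cube \<Longrightarrow> f\<^sub>0 p \<le> real n" using G_pos_bounded[OF nontriv(1)] by blast
    with bound[OF nontriv(1)] have "\<phi> f\<^sub>0 \<le> real n * c" by blast
    moreover have "\<phi> f\<^sub>0 > 0" using nonneg[OF nontriv(1)] nontriv(2) by simp
    ultimately have "c \<noteq> 0" by auto
    then show ?thesis using nonneg[of one_fun] by (simp add: c_def)
  qed
  define ker where "ker = {f \<in> ?G. \<phi> f = 0}"
  define zs where "zs f = {x \<in> unit_cube. f x = 0}" for f :: "real ^ 'm \<Rightarrow> real"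
  \<comment> \<open>An element of the kernel without zeros would have a positive minimum, so a
    multiple of it, still in the kernel, would dominate \<open>one_fun\<close>.\<close>
  have pos_zero: "zs f \<noteq> {}" if "f \<in> ker" for f
  proof
    assume z: "zs f = {}"
    have f: "f \<in> ?G" "\<phi> f = 0" using that by (auto simp: ker_def)
    have ne: "(unit_cube :: (real ^ 'm) set) \<noteq> {}" by (auto simp: set_eq_iff mem_box_cart intro: exI[of _ 0])
    obtain x0 where x0: "x0 \<in> unit_cube" "\<And>y. y \<in> unit_cube \<Longrightarrow> f x0 \<le> f y"
      using continuous_attains_inf[OF compact_cbox ne, of f] f by (auto simp: G_pos_iff mcnaughton_iff)
    have "f x0 > 0" using x0(1) f z by (force simp: zs_def G_pos_iff)
    then obtain n :: nat where "1 < real n * f x0" using reals_Archimedean3 by blast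
    then have "1 \<le> nat_multiple n f p" if "p \<in> unit_cube" for p
      using x0(2)[OF that] that mult_left_mono[of "f x0" "f p" "real n"] by (simp add: nat_multiple_apply)
    then have "c \<le> \<phi> (nat_multiple n f)"
      unfolding c_def using f by (intro mono) auto
    with c f mult[of f n] show False by simp
  qed
  \<comment> \<open>A sum of nonnegative functions vanishes only where all summands do; this
    supplies the finite intersection property.\<close>
  have comb: "\<exists>h\<in>ker. zs h \<subseteq> (\<Inter>f\<in>F. zs f)" if "finite F" "F \<subseteq> ker" for F
    using that
  proof induction
    case empty
    have "hoop_zero G_pos \<in> ker" by (simp add: ker_def zero)
    then show ?case by auto
  next
    case (insert f F)
    then obtain h where h: "h \<in> ker" "zs h \<subseteq> (\<Inter>f\<in>F. zs f)" by auto
    have f: "f \<in> ker" using insert by auto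
    have "hoop_plus G_pos f h \<in> ker" using f h add by (auto simp: ker_def)
    moreover have "zs (hoop_plus G_pos f h) \<subseteq> zs f \<inter> zs h"
      using f h(1) by (auto simp: zs_def hoop_plus_G_pos ker_def G_pos_iff add_nonneg_eq_0_iff)
    ultimately show ?case using h by (intro bexI[of _ "hoop_plus G_pos f h"]) auto
  qed
  have "unit_cube \<inter> \<Inter> (zs ` ker) \<noteq> {}"
  proof (rule compact_imp_fip[OF compact_cbox])
    fix T assume "T \<in> zs ` ker"
    then show "closed T"
      unfolding zs_def using continuous_closed_preimage_constant[of unit_cube _ 0]
      by (auto simp: ker_def G_pos_iff mcnaughton_iff)
  next
    fix F' assume "finite F'" "F' \<subseteq> zs ` ker"
    then obtain F where F: "F \<subseteq> ker" "finite F" "F' = zs ` F" by (meson finite_subset_image)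
    then obtain h where h: "h \<in> ker" "zs h \<subseteq> \<Inter> F'" using comb by blast
    moreover have "zs h \<subseteq> unit_cube" by (auto simp: zs_def)
    ultimately show "unit_cube \<inter> \<Inter> F' \<noteq> {}" using pos_zero[of h] by blast
  qed
  then obtain q where q: "q \<in> unit_cube" "\<And>f. f \<in> ker \<Longrightarrow> f q = 0" by (auto simp: zs_def)
  \<comment> \<open>A rational k / l strictly between the two sides puts the truncated difference of
    l f and k into the kernel. It then vanishes at \<open>q\<close>, which contradicts k / l < f
    q.\<close>
  have le: "f q \<le> \<phi> f / c" if f: "f \<in> ?G" for f
  proof (rule ccontr)
    assume "\<not> f q \<le> \<phi> f / c"
    then obtain r where r: "r \<in> \<rat>" "\<phi> f / c < r" "r < f q" using Rats_dense_in_real[of "\<phi> f / c" "f q"] by auto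
    moreover have "\<phi> f / c \<ge> 0" using nonneg[OF f] c by simp
    ultimately obtain k l :: nat where kl: "l \<noteq> 0" "r = real k / real l"
      using Rats_abs_nat_div_natE[OF r(1)] by (metis abs_of_pos le_less_trans)
    let ?g = "hoop_monus G_pos (nat_multiple l f) (nat_multiple k one_fun)"
    have "\<phi> ?g = max 0 (real l * \<phi> f - real k * c)"
      using f by (simp add: monus mult c_def)
    moreover have "real l * \<phi> f - real k * c < 0"
      using r(2) kl c by (simp add: field_simps)
    ultimately have "?g \<in> ker" using f by (simp add: ker_def)
    from q(2)[OF this] have "real l * f q \<le> real k"
      using q(1) by (simp add: hoop_monus_G_pos nat_multiple_apply max_def split: if_splits)
    with r(3) kl show False by (simp add: field_simps)
  qed
  \<comment> \<open>The reverse inequality is \<open>le\<close> for the complement n - f, which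
    involves no truncation because n bounds f.\<close>
  have "\<phi> f = c * f q" if f: "f \<in> ?G" for f
  proof -
    obtain n where n: "\<And>p. p \<in> unit_cube \<Longrightarrow> f p \<le> real n" using G_pos_bounded[OF f] by blast
    let ?g = "hoop_monus G_pos (nat_multiple n one_fun) f"
    have "?g q \<le> \<phi> ?g / c" using f by (intro le) simp
    moreover have "?g q = real n - f q"
      using n[OF q(1)] q(1) by (simp add: hoop_monus_G_pos nat_multiple_apply)
    moreover have "\<phi> ?g = real n * c - \<phi> f"
      using bound[OF f n] f by (simp add: monus mult flip: c_def)
    ultimately have "real n - f q \<le> (real n * c - \<phi> f) / c" by simp
    then have "\<phi> f / c \<le> f q" using c by (simp add: diff_divide_distrib)
    with le[OF f] c show ?thesis by (simp add: field_simps)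
  qed
  with q(1) c that show ?thesis unfolding c_def by blast
qed

subsection \<open>The dual map of an automorphism\<close>

lemma hoop_autoD:
  assumes "\<sigma> \<in> hoop_auto H"
  shows "bij_betw \<sigma> (carrier H) (carrier H)" "\<sigma> \<in> extensional (carrier H)"
    "f \<in> carrier H \<Longrightarrow> g \<in> carrier H \<Longrightarrow> \<sigma> (hoop_plus H f g) = hoop_plus H (\<sigma> f) (\<sigma> g)"
    "f \<in> carrier H \<Longrightarrow> g \<in> carrier H \<Longrightarrow> \<sigma> (hoop_monus H f g) = hoop_monus H (\<sigma> f) (\<sigma> g)"
    "f \<in> carrier H \<Longrightarrow> \<sigma> f \<in> carrier H"
  using assms by (auto simp: hoop_auto_def Bij_def bij_betw_def)

lemma hoop_auto_evaluation:
  fixes \<sigma> :: "(real ^ 'm::finite \<Rightarrow> real) \<Rightarrow> (real ^ 'm \<Rightarrow> real)"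
  assumes \<sigma>: "\<sigma> \<in> hoop_auto G_pos" and p: "p \<in> unit_cube"
  shows "dual_map \<sigma> p \<in> unit_cube" "\<sigma> one_fun p > 0"
    "f \<in> carrier G_pos \<Longrightarrow> \<sigma> f p = \<sigma> one_fun p * f (dual_map \<sigma> p)"
proof -
  note \<sigma>D = hoop_autoD[OF \<sigma>]
  \<comment> \<open>The preimage of \<open>one_fun\<close> shows that \<open>\<sigma>\<close>
    followed by evaluation at \<open>p\<close> is not identically 0.\<close>
  obtain g where g: "g \<in> carrier G_pos" "\<sigma> g = one_fun"
    using bij_betw_imp_surj_on[OF \<sigma>D(1)] one_fun_in_G_pos by (metis imageE)
  obtain q where q: "q \<in> unit_cube" "\<sigma> one_fun p > 0" "\<And>f. f \<in> carrier G_pos \<Longrightarrow> \<sigma> f p = \<sigma> one_fun p * f q"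
  proof (rule hoop_hom_to_real_is_evaluation[of "\<lambda>f. \<sigma> f p" g])
    show "\<sigma> f p \<ge> 0" if "f \<in> carrier G_pos" for f
      using \<sigma>D(5)[OF that] p by (auto simp: G_pos_iff)
    show "\<sigma> (hoop_plus G_pos f g) p = \<sigma> f p + \<sigma> g p" if "f \<in> carrier G_pos" "g \<in> carrier G_pos" for f g
      using that p by (simp add: \<sigma>D(3) hoop_plus_G_pos)
    show "\<sigma> (hoop_monus G_pos f g) p = max 0 (\<sigma> f p - \<sigma> g p)" if "f \<in> carrier G_pos" "g \<in> carrier G_pos" for f g
      using that p by (simp add: \<sigma>D(4) hoop_monus_G_pos)
    show "g \<in> carrier G_pos" "\<sigma> g p \<noteq> 0" using g p by auto
  qed (rule that)
  have "dual_map \<sigma> p = q"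
    using q(1,2) q(3)[OF proj_fun_in_G_pos] by (simp add: dual_map_def vec_eq_iff)
  with q show "dual_map \<sigma> p \<in> unit_cube" "\<sigma> one_fun p > 0"
    "f \<in> carrier G_pos \<Longrightarrow> \<sigma> f p = \<sigma> one_fun p * f (dual_map \<sigma> p)" by blast+
qed

lemma continuous_on_G_pos: "f \<in> carrier G_pos \<Longrightarrow> continuous_on unit_cube f"
  by (simp add: G_pos_iff mcnaughton_iff)

lemma continuous_on_dual_map:
  assumes \<sigma>: "\<sigma> \<in> hoop_auto G_pos"
  shows "continuous_on unit_cube (dual_map \<sigma>)"
  unfolding dual_map_def
proof (intro continuous_on_vec_lambda continuous_on_divide)
  show "\<forall>p\<in>unit_cube. \<sigma> one_fun p \<noteq> 0"
    using hoop_auto_evaluation(2)[OF \<sigma>] by fastforce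
qed (simp_all add: continuous_on_G_pos hoop_autoD[OF \<sigma>])

lemma hoop_auto_inverse:
  assumes \<sigma>: "\<sigma> \<in> hoop_auto G_pos"
  obtains \<tau> where "\<tau> \<in> hoop_auto G_pos" "\<And>f. f \<in> carrier G_pos \<Longrightarrow> \<sigma> (\<tau> f) = f"
    "\<And>f. f \<in> carrier G_pos \<Longrightarrow> \<tau> (\<sigma> f) = f"
proof -
  let ?G = "carrier G_pos :: (real ^ 'a \<Rightarrow> real) set"
  define \<tau> where "\<tau> = restrict (inv_into ?G \<sigma>) ?G"
  note \<sigma>D = hoop_autoD[OF \<sigma>]
  have \<tau>1: "\<sigma> (\<tau> f) = f" and \<tau>c: "\<tau> f \<in> ?G" if "f \<in> ?G" for f
    using \<sigma>D(1) that by (auto simp: \<tau>_def bij_betw_inv_into_right bij_betw_def inv_into_into)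
  have \<tau>2: "\<tau> (\<sigma> f) = f" if "f \<in> ?G" for f
    using \<sigma>D(1) \<sigma>D(5)[OF that] that by (auto simp: \<tau>_def bij_betw_inv_into_left)
  have "\<tau> \<in> Bij ?G"
    using \<sigma> unfolding \<tau>_def by (intro restrict_inv_into_Bij) (auto simp: hoop_auto_def)
  moreover have "\<tau> (hoop_plus G_pos f g) = hoop_plus G_pos (\<tau> f) (\<tau> g)" if "f \<in> ?G" "g \<in> ?G" for f g
    using \<tau>2[of "hoop_plus G_pos (\<tau> f) (\<tau> g)"] \<sigma>D(3)[of "\<tau> f" "\<tau> g"] that \<tau>1 \<tau>c by simp
  moreover have "\<tau> (hoop_monus G_pos f g) = hoop_monus G_pos (\<tau> f) (\<tau> g)" if "f \<in> ?G" "g \<in> ?G" for f g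
    using \<tau>2[of "hoop_monus G_pos (\<tau> f) (\<tau> g)"] \<sigma>D(4)[of "\<tau> f" "\<tau> g"] that \<tau>1 \<tau>c by simp
  moreover have "\<tau> (hoop_zero G_pos) = hoop_zero G_pos"
    using \<tau>2[of "hoop_zero G_pos"] \<sigma> by (simp add: hoop_auto_def)
  ultimately have "\<tau> \<in> hoop_auto G_pos" by (simp add: hoop_auto_def)
  then show ?thesis using that \<tau>1 \<tau>2 by blast
qed

text \<open>Evaluating \<open>\<sigma> (\<tau> f) = f\<close> at \<open>p\<close> expresses f(p) as
  a constant times the value of f at the composed point; \<open>one_fun\<close> shows that the
  constant is 1, and the projections then identify the point.\<close>

lemma dual_map_inverse:
  assumes \<sigma>: "\<sigma> \<in> hoop_auto G_pos" and \<tau>: "\<tau> \<in> hoop_auto G_pos"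
    and inv: "\<And>f. f \<in> carrier G_pos \<Longrightarrow> \<sigma> (\<tau> f) = f" and p: "p \<in> unit_cube"
  shows "dual_map \<tau> (dual_map \<sigma> p) = p" "\<sigma> one_fun p * \<tau> one_fun (dual_map \<sigma> p) = 1"
proof -
  let ?q = "dual_map \<sigma> p"
  have q: "?q \<in> unit_cube" by (rule hoop_auto_evaluation(1)[OF \<sigma> p])
  have eq: "f p = \<sigma> one_fun p * (\<tau> one_fun ?q * f (dual_map \<tau> ?q))" if f: "f \<in> carrier G_pos" for f
  proof -
    have "f p = \<sigma> one_fun p * \<tau> f ?q"
      using hoop_auto_evaluation(3)[OF \<sigma> p hoop_autoD(5)[OF \<tau> f]] inv[OF f] by simp
    then show ?thesis using hoop_auto_evaluation(3)[OF \<tau> q f] by simp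
  qed
  have Tq: "dual_map \<tau> ?q \<in> unit_cube" by (rule hoop_auto_evaluation(1)[OF \<tau> q])
  show 1: "\<sigma> one_fun p * \<tau> one_fun ?q = 1"
    using eq[OF one_fun_in_G_pos] p Tq by simp
  show "dual_map \<tau> ?q = p"
    using eq[OF proj_fun_in_G_pos] p Tq 1 by (simp add: vec_eq_iff flip: mult.assoc)
qed

lemma homeomorphism_dual_map:
  assumes \<sigma>: "\<sigma> \<in> hoop_auto G_pos" and \<tau>: "\<tau> \<in> hoop_auto G_pos"
    and inv: "\<And>f. f \<in> carrier G_pos \<Longrightarrow> \<sigma> (\<tau> f) = f" "\<And>f. f \<in> carrier G_pos \<Longrightarrow> \<tau> (\<sigma> f) = f"
  shows "homeomorphism unit_cube unit_cube (dual_map \<sigma>) (dual_map \<tau>)"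
  by (rule homeomorphismI)
    (auto simp: continuous_on_dual_map \<sigma> \<tau> hoop_auto_evaluation(1) dual_map_inverse(1)[OF \<sigma> \<tau> inv(1)]
      dual_map_inverse(1)[OF \<tau> \<sigma> inv(2)])

lemma rational_points_dense:
  fixes f :: "real ^ 'm::finite \<Rightarrow> real"
  assumes f: "continuous_on unit_cube f" and g: "continuous_on unit_cube g"
    and eq: "\<And>p. p \<in> unit_cube \<Longrightarrow> (\<And>i. p $ i \<in> \<rat>) \<Longrightarrow> f p = g p" and p: "p \<in> unit_cube"
  shows "f p = g p"
proof -
  \<comment> \<open>Rounding down keeps the rational approximations inside the cube;
    \<open>Suc n\<close> avoids a zero denominator.\<close>
  define q :: "nat \<Rightarrow> real ^ 'm" where "q n = (\<chi> i. of_int \<lfloor>real (Suc n) * p $ i\<rfloor> / real (Suc n))" for n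
  have p01: "0 \<le> p $ i" "p $ i \<le> 1" for i using p by (auto simp: mem_box_cart)
  have qp: "q n $ i \<le> p $ i" "p $ i - 1 / real (Suc n) \<le> q n $ i" for n i
  proof -
    have "of_int \<lfloor>real (Suc n) * p $ i\<rfloor> \<le> p $ i * real (Suc n)" by (simp add: mult.commute)
    then show "q n $ i \<le> p $ i" unfolding q_def vec_lambda_beta by (subst pos_divide_le_eq) auto
    have "(p $ i - 1 / real (Suc n)) * real (Suc n) = real (Suc n) * p $ i - 1"
      by (simp add: field_simps)
    also have "\<dots> \<le> of_int \<lfloor>real (Suc n) * p $ i\<rfloor>" by linarith
    finally show "p $ i - 1 / real (Suc n) \<le> q n $ i"
      unfolding q_def vec_lambda_beta by (subst pos_le_divide_eq) auto
  qed
  have qD: "q n \<in> unit_cube" for n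
    unfolding mem_box_cart
  proof
    fix i
    have "0 \<le> q n $ i" unfolding q_def using p01(1)[of i] by simp
    then show "0 $ i \<le> q n $ i \<and> q n $ i \<le> 1 $ i" using qp(1)[of n i] p01(2)[of i] by simp
  qed
  have lim: "q \<longlonglongrightarrow> p"
  proof (rule vec_tendstoI)
    fix i
    have "(\<lambda>n. p $ i - 1 / real (Suc n)) \<longlonglongrightarrow> p $ i - 0"
      by (intro tendsto_intros LIMSEQ_Suc[OF lim_1_over_n])
    then show "(\<lambda>n. q n $ i) \<longlonglongrightarrow> p $ i"
      by (intro tendsto_sandwich[of "\<lambda>n. p $ i - 1 / real (Suc n)" "\<lambda>n. q n $ i" _ "\<lambda>_. p $ i"])
        (use qp in auto)
  qed
  have "(\<lambda>n. f (q n)) \<longlonglongrightarrow> f p" "(\<lambda>n. g (q n)) \<longlonglongrightarrow> g p"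
    using f g p qD lim by (auto simp: continuous_on_sequentially o_def)
  moreover have "f (q n) = g (q n)" for n
    by (rule eq[OF qD]) (auto simp: q_def)
  ultimately show ?thesis using LIMSEQ_unique by auto
qed

lemma rational_common_denominator:
  fixes p :: "real ^ 'm::finite"
  assumes "\<And>i. p $ i \<in> \<rat>"
  obtains d :: int and u :: "int ^ 'm" where "d > 0" "\<And>i. of_int d * p $ i = of_int (u $ i)"
proof -
  have "\<exists>d>0. \<forall>i\<in>I. of_int d * p $ i \<in> \<int>" if "finite I" for I
    using that
  proof induction
    case empty
    then show ?case by (auto intro: exI[of _ "1 :: int"])
  next
    case (insert i I)
    then obtain d :: int where d: "d > 0" "\<forall>i\<in>I. of_int d * p $ i \<in> \<int>" by auto
    obtain a b :: int where ab: "b > 0" "p $ i = of_int a / of_int b"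
      using assms[of i] by (metis Rats_cases')
    have "of_int (d * b) * p $ i = of_int (d * a)" using ab by simp
    moreover have "of_int (d * b) * p $ j \<in> \<int>" if "j \<in> I" for j
      using d(2) that Ints_mult[OF Ints_of_int[of b], of "of_int d * p $ j"] by (simp add: mult_ac)
    ultimately show ?case
      using d ab by (intro exI[of _ "d * b"]) (auto simp del: of_int_mult)
  qed
  from this[of UNIV] obtain d :: int where d: "d > 0" "\<And>i. of_int d * p $ i \<in> \<int>" by auto
  have "of_int d * p $ i = of_int ((\<chi> i. \<lfloor>of_int d * p $ i\<rfloor>) $ i)" for i
    using d(2)[of i] by (auto elim: Ints_cases)
  with d(1) that show ?thesis by blast
qed

text \<open>At a rational point \<open>p\<close> the values of the elements of the positive cone form a discrete
  set, so \<open>\<sigma> \<one> p\<close> is the quotient of the least positive values at \<open>p\<close> and at the dual point.\<close>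

lemma hoop_auto_one_le:
  fixes \<sigma> \<sigma>' :: "(real ^ 'm::finite \<Rightarrow> real) \<Rightarrow> (real ^ 'm \<Rightarrow> real)"
  assumes \<sigma>: "\<sigma> \<in> hoop_auto G_pos" and \<sigma>': "\<sigma>' \<in> hoop_auto G_pos"
    and p: "p \<in> unit_cube" "\<And>i. p $ i \<in> \<rat>" and eq: "dual_map \<sigma> p = dual_map \<sigma>' p"
  shows "\<sigma>' one_fun p \<le> \<sigma> one_fun p"
proof -
  let ?G = "carrier G_pos :: (real ^ 'm \<Rightarrow> real) set"
  obtain d :: int and u :: "int ^ 'm" where d: "d > 0" "\<And>i. of_int d * p $ i = of_int (u $ i)"
    using rational_common_denominator[OF p(2)] by blast
  \<comment> \<open>Since the forms have integer coefficients, \<open>d\<close> is a common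
    denominator of all values at \<open>p\<close>.\<close>
  have int: "\<exists>n::nat. of_int d * f p = real n" if f: "f \<in> ?G" for f
  proof -
    obtain l where l: "f p = int_affine l p" using f p(1) unfolding G_pos_iff mcnaughton_iff by blast
    have "of_int d * f p = (\<Sum>i\<in>UNIV. of_int (fst l $ i) * (of_int d * p $ i)) + of_int (d * snd l)"
      by (simp add: l int_affine_def distrib_left sum_distrib_left mult_ac)
    also have "\<dots> = of_int ((\<Sum>i\<in>UNIV. fst l $ i * u $ i) + d * snd l)"
      by (simp add: d(2))
    finally have "of_int d * f p \<in> \<int>" by (metis Ints_of_int)
    moreover have "of_int d * f p \<ge> 0" using d(1) f p(1) by (simp add: G_pos_iff)
    ultimately show ?thesis by (metis Ints_cases of_int_0_le_iff of_int_of_nat_eq zero_le_imp_eq_int)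
  qed
  define N where "N = {n::nat. n > 0 \<and> (\<exists>f\<in>?G. of_int d * f p = real n)}"
  define n0 where "n0 = (LEAST n. n \<in> N)"
  have "nat d \<in> N" using d(1) p(1) by (auto simp: N_def intro!: bexI[of _ one_fun])
  then have "n0 \<in> N" unfolding n0_def by (rule LeastI)
  have min: "n0 \<le> n" if "n \<in> N" for n using that unfolding n0_def by (rule Least_le)
  obtain f where f: "f \<in> ?G" "of_int d * f p = real n0" "n0 > 0" using \<open>n0 \<in> N\<close> by (auto simp: N_def)
  \<comment> \<open>\<open>f\<close>, which attains the least positive value, is the image of
    \<open>\<tau> f\<close> under \<open>\<sigma>'\<close>. Replacing \<open>\<sigma>'\<close> by
    \<open>\<sigma>\<close> multiplies its value at \<open>p\<close> by the quotient of the two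
    factors there, and minimality bounds that quotient below by 1.\<close>
  obtain \<tau> where \<tau>: "\<tau> \<in> hoop_auto G_pos" "\<sigma>' (\<tau> f) = f"
    using hoop_auto_inverse[OF \<sigma>'] f(1) by metis
  have g: "\<tau> f \<in> ?G" using hoop_autoD(5)[OF \<tau>(1) f(1)] .
  have fp: "f p = \<sigma>' one_fun p * \<tau> f (dual_map \<sigma> p)"
    using hoop_auto_evaluation(3)[OF \<sigma>' p(1) g] \<tau>(2) eq by simp
  have \<sigma>f: "\<sigma> (\<tau> f) p = \<sigma> one_fun p * \<tau> f (dual_map \<sigma> p)"
    by (rule hoop_auto_evaluation(3)[OF \<sigma> p(1) g])
  have "f p > 0" using f(2,3) d(1) by (metis of_nat_0_less_iff of_int_0_less_iff zero_less_mult_pos)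
  then have gp: "\<tau> f (dual_map \<sigma> p) > 0"
    using fp hoop_auto_evaluation(2)[OF \<sigma>' p(1)] by (simp add: zero_less_mult_iff)
  then have pos: "\<sigma> (\<tau> f) p > 0" using \<sigma>f hoop_auto_evaluation(2)[OF \<sigma> p(1)] by simp
  have \<sigma>\<tau>: "\<sigma> (\<tau> f) \<in> ?G" using hoop_autoD(5)[OF \<sigma> g] .
  obtain n where n: "of_int d * \<sigma> (\<tau> f) p = real n" using int[OF \<sigma>\<tau>] by blast
  have "n > 0" using n pos d(1) by (metis of_nat_0_less_iff of_int_0_less_iff mult_pos_pos)
  then have "n \<in> N" using n \<sigma>\<tau> by (auto simp: N_def)
  from min[OF this] have "of_int d * f p \<le> of_int d * \<sigma> (\<tau> f) p" using f(2) n by simp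
  then have "f p \<le> \<sigma> (\<tau> f) p" using d(1) by simp
  with fp \<sigma>f gp show ?thesis by simp
qed

lemma hoop_auto_unique:
  fixes \<sigma> \<sigma>' :: "(real ^ 'm::finite \<Rightarrow> real) \<Rightarrow> (real ^ 'm \<Rightarrow> real)"
  assumes \<sigma>: "\<sigma> \<in> hoop_auto G_pos" and \<sigma>': "\<sigma>' \<in> hoop_auto G_pos"
    and eq: "\<And>p. p \<in> unit_cube \<Longrightarrow> dual_map \<sigma> p = dual_map \<sigma>' p"
  shows "\<sigma> = \<sigma>'"
proof (rule extensionalityI[OF hoop_autoD(2)[OF \<sigma>] hoop_autoD(2)[OF \<sigma>']])
  have one: "\<sigma> one_fun p = \<sigma>' one_fun p" if "p \<in> unit_cube" for p
  proof (rule rational_points_dense[OF _ _ _ that])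
    fix q :: "real ^ 'm" assume q: "q \<in> unit_cube" "\<And>i. q $ i \<in> \<rat>"
    show "\<sigma> one_fun q = \<sigma>' one_fun q"
      using hoop_auto_one_le[OF \<sigma> \<sigma>' q eq[OF q(1)]] hoop_auto_one_le[OF \<sigma>' \<sigma> q eq[OF q(1), symmetric]]
      by simp
  qed (auto simp: continuous_on_G_pos hoop_autoD(5)[OF \<sigma>] hoop_autoD(5)[OF \<sigma>'])
  fix f :: "real ^ 'm \<Rightarrow> real" assume f: "f \<in> carrier G_pos"
  show "\<sigma> f = \<sigma>' f"
  proof (rule G_pos_eqI)
    fix p :: "real ^ 'm" assume p: "p \<in> unit_cube"
    show "\<sigma> f p = \<sigma>' f p"
      unfolding hoop_auto_evaluation(3)[OF \<sigma> p f] hoop_auto_evaluation(3)[OF \<sigma>' p f] one[OF p] eq[OF p] ..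
  qed (simp_all add: hoop_autoD(5)[OF \<sigma> f] hoop_autoD(5)[OF \<sigma>' f])
qed

subsection \<open>Unimodular integer matrices\<close>

text \<open>Used twice: for the cells of lower dimension in a complex, and for the finitely many
  candidate inverse matrices on one cell.\<close>

lemma interior_finite_Union_empty:
  assumes "finite \<C>" "\<And>C. C \<in> \<C> \<Longrightarrow> closed C" "\<And>C. C \<in> \<C> \<Longrightarrow> interior C = {}"
  shows "interior (\<Union>\<C>) = {}"
  using assms
proof (induction rule: finite_induct)
  case (insert C \<C>)
  then show ?case using interior_closed_Un_empty_interior[of C "\<Union>\<C>"] by simp
qed simp

abbreviation real_matrix :: "int ^ 'n ^ 'k \<Rightarrow> real ^ 'n::finite ^ 'k::finite" where
  "real_matrix \<equiv> map_matrix of_int"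

lemma det_real_matrix: "det (real_matrix A) = of_int (det A)"
  by (simp add: det_def of_int_sum of_int_prod)

lemma real_matrix_mult: "real_matrix (A ** B) = real_matrix A ** real_matrix B"
  by (simp add: vec_eq_iff matrix_matrix_mult_def)

lemma real_matrix_eq_iff: "real_matrix A = real_matrix B \<longleftrightarrow> A = B"
  by (auto simp: vec_eq_iff)

lemma real_matrix_mat_1: "real_matrix (mat 1) = mat 1"
  by (auto simp: vec_eq_iff mat_def)

text \<open>Cramer's rule: \<open>B\<close> is the adjugate, whose entries are integer determinants,
  and the determinant it would be divided by is 1.\<close>

lemma integer_matrix_inverse:
  fixes A :: "int ^ 'n::finite ^ 'n"
  assumes "det A = 1"
  obtains B where "A ** B = mat 1" "B ** A = mat 1"
proof -
  let ?A = "real_matrix A"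
  define B :: "int ^ 'n ^ 'n" where
    "B = (\<chi> k l. det (\<chi> i j. if j = k then of_bool (i = l) else A $ i $ j))"
  have d: "det ?A = 1" using assms by (simp add: det_real_matrix)
  have "real_matrix B $ k $ l = det (\<chi> i j. if j = k then axis l 1 $ i else ?A $ i $ j) / det ?A" for k l
  proof -
    have "(\<chi> i j. if j = k then axis l 1 $ i else ?A $ i $ j) =
        real_matrix (\<chi> i j. if j = k then of_bool (i = l) else A $ i $ j)"
      by (auto simp: vec_eq_iff axis_def)
    then show ?thesis by (simp add: assms det_real_matrix B_def)
  qed
  then have "(\<chi> k. real_matrix B $ k $ l) = (\<chi> k. det (\<chi> i j. if j = k then axis l 1 $ i else ?A $ i $ j) / det ?A)" for l
    by simp
  then have "?A *v (\<chi> k. real_matrix B $ k $ l) = axis l 1" for l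
    using d by (simp add: cramer)
  then have "(?A *v (\<chi> k. real_matrix B $ k $ l)) $ i = axis l 1 $ i" for i l
    by simp
  then have "?A ** real_matrix B = mat 1"
    by (auto simp: vec_eq_iff matrix_matrix_mult_def matrix_vector_mult_def mat_def axis_def)
  then have "?A ** real_matrix B = mat 1" "real_matrix B ** ?A = mat 1"
    using matrix_left_right_inverse by blast+
  then have "A ** B = mat 1" "B ** A = mat 1"
    by (metis real_matrix_eq_iff real_matrix_mat_1 real_matrix_mult)+
  then show ?thesis by (rule that)
qed

lemma Gcd_dvd_Gcd_mult:
  fixes A :: "int ^ 'n::finite ^ 'k::finite"
  shows "Gcd (range (($) w)) dvd Gcd (range (($) (A *v w)))"
  by (rule Gcd_greatest) (auto simp: matrix_vector_mult_def intro!: dvd_sum dvd_mult)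

text \<open>An integer matrix can only enlarge the gcd of the entries in the divisibility order; the
  integer inverse gives the converse divisibility.\<close>

lemma Gcd_mult_unimodular:
  fixes A :: "int ^ 'n::finite ^ 'n"
  assumes "det A = 1"
  shows "Gcd (range (($) (A *v w))) = Gcd (range (($) w))"
proof -
  obtain B where B: "B ** A = mat 1" using integer_matrix_inverse[OF assms] by metis
  have "B *v (A *v w) = w" by (simp add: matrix_vector_mul_assoc B)
  then have "Gcd (range (($) (A *v w))) dvd Gcd (range (($) w))"
    using Gcd_dvd_Gcd_mult[of "A *v w" B] by simp
  with Gcd_dvd_Gcd_mult[of w A] show ?thesis
    by (simp add: associated_eqI)
qed

text \<open>The factor is determined by the primitive integer vector on the ray of \<open>homog p\<close>.\<close>

lemma unimodular_factor_unique_rational: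
  fixes A A' :: "int ^ 'm::finite option ^ 'm option"
  assumes det: "det A = 1" "det A' = 1" and p: "\<And>i. p $ i \<in> \<rat>" and c: "c > 0" "c' > 0"
    and A: "real_matrix A *v homog p = c *\<^sub>R homog q"
    and A': "real_matrix A' *v homog p = c' *\<^sub>R homog q"
  shows "c = c'"
proof -
  obtain d :: int and u :: "int ^ 'm" where d: "d > 0" "\<And>i. of_int d * p $ i = of_int (u $ i)"
    using rational_common_denominator[OF p] by blast
  \<comment> \<open>\<open>w\<close> is an integer vector on the ray of \<open>homog p\<close>; its
    entry \<open>d\<close> at \<open>None\<close> keeps the gcd nonzero.\<close>
  define w :: "int ^ 'm option" where "w = (\<chi> i. case i of None \<Rightarrow> d | Some j \<Rightarrow> u $ j)"
  have w: "of_int (w $ i) = of_int d * homog p $ i" for i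
    using d(2) by (cases i) (auto simp: w_def)
  have Aw: "of_int ((M *v w) $ i) = of_int d * (real_matrix M *v homog p) $ i" for i and M :: "int ^ 'm option ^ 'm option"
    by (simp add: matrix_vector_mult_def w sum_distrib_left mult_ac)
  let ?x = "A *v w" and ?x' = "A' *v w"
  have x: "of_int (?x $ i) = of_int d * c * homog q $ i" for i by (simp add: Aw A)
  have x': "of_int (?x' $ i) = of_int d * c' * homog q $ i" for i by (simp add: Aw A')
  \<comment> \<open>Both images lie on the ray of \<open>homog q\<close>, so scaling each by the
    \<open>None\<close> entry of the other makes them equal. As both have the same gcd as
    \<open>w\<close>, the \<open>None\<close> entries d c and d c' agree in absolute value.\<close>
  have "real_of_int (?x' $ None * ?x $ i) = real_of_int (?x $ None * ?x' $ i)" for i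
    by (simp only: of_int_mult x x') (simp add: mult_ac)
  then have eq: "?x' $ None * ?x $ i = ?x $ None * ?x' $ i" for i
    by (metis of_int_eq_iff)
  have "Gcd ((*) (?x' $ None) ` range (($) ?x)) = Gcd ((*) (?x $ None) ` range (($) ?x'))"
    by (simp add: image_image eq)
  moreover have "Gcd (range (($) ?x)) = Gcd (range (($) w))" "Gcd (range (($) ?x')) = Gcd (range (($) w))"
    by (simp_all add: Gcd_mult_unimodular det)
  moreover have "Gcd (range (($) w)) \<noteq> 0"
  proof -
    have "w $ None \<noteq> 0" using d(1) by (simp add: w_def)
    then show ?thesis by (auto simp: Gcd_0_iff)
  qed
  ultimately have "\<bar>?x' $ None\<bar> = \<bar>?x $ None\<bar>"
    by (simp add: Gcd_mult abs_mult)
  then have "\<bar>real_of_int (?x' $ None)\<bar> = \<bar>real_of_int (?x $ None)\<bar>" by linarith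
  then show ?thesis using c d(1) by (simp add: x x' abs_mult)
qed

definition row_affine :: "int ^ 'm::finite option \<Rightarrow> (int ^ 'm) \<times> int" where
  "row_affine w = ((\<chi> j. w $ Some j), w $ None)"

definition affine_row :: "(int ^ 'm::finite) \<times> int \<Rightarrow> int ^ 'm option" where
  "affine_row l = (\<chi> i. case i of None \<Rightarrow> snd l | Some j \<Rightarrow> fst l $ j)"

lemma int_affine_row_affine: "int_affine (row_affine w) p = (\<Sum>i\<in>UNIV. of_int (w $ i) * homog p $ i)"
  by (simp add: int_affine_def row_affine_def sum_UNIV_option)

lemma int_affine_affine_row: "int_affine l p = (\<Sum>i\<in>UNIV. of_int (affine_row l $ i) * homog p $ i)"
  by (simp add: int_affine_def affine_row_def sum_UNIV_option)

lemma real_matrix_mult_homog: "(real_matrix A *v homog p) $ i = int_affine (row_affine (A $ i)) p"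
  by (simp add: int_affine_row_affine matrix_vector_mult_def)

text \<open>The projective map divides by \<open>c\<close>; multiplying by \<open>c\<close> again
  leaves the row vector of \<open>l\<close> times \<open>A\<close>, which is an integer
  form.\<close>

lemma int_affine_projective:
  assumes "real_matrix A *v homog p = c *\<^sub>R homog q"
  shows "c * int_affine l q = int_affine (row_affine (affine_row l v* A)) p"
proof -
  have "c * int_affine l q = (\<Sum>i\<in>UNIV. of_int (affine_row l $ i) * (real_matrix A *v homog p) $ i)"
    by (simp add: int_affine_affine_row assms sum_distrib_left mult_ac)
  also have "\<dots> = (\<Sum>i\<in>UNIV. \<Sum>j\<in>UNIV. of_int (affine_row l $ i) * of_int (A $ i $ j) * homog p $ j)"
    by (simp add: matrix_vector_mult_def sum_distrib_left mult_ac)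
  also have "\<dots> = (\<Sum>j\<in>UNIV. \<Sum>i\<in>UNIV. of_int (affine_row l $ i) * of_int (A $ i $ j) * homog p $ j)"
    by (rule sum.swap)
  also have "\<dots> = int_affine (row_affine (affine_row l v* A)) p"
    by (simp add: int_affine_row_affine vector_matrix_mult_def sum_distrib_left mult_ac)
  finally show ?thesis .
qed

text \<open>\<open>mcnaughton\<close> asks for continuity and a finite list of forms, so it suffices
  that at each point some matrix from a finite set describes \<open>S\<close>.\<close>

lemma projective_pullback_in_G_pos:
  fixes S :: "real ^ 'm::finite \<Rightarrow> real ^ 'm"
  assumes f: "f \<in> carrier G_pos" and S: "continuous_on unit_cube S" "S \<in> unit_cube \<rightarrow> unit_cube"
    and \<mu>: "continuous_on unit_cube \<mu>" "\<And>p. p \<in> unit_cube \<Longrightarrow> \<mu> p > 0"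
    and M: "finite M" "\<And>p. p \<in> unit_cube \<Longrightarrow> \<exists>A\<in>M. real_matrix A *v homog p = \<mu> p *\<^sub>R homog (S p)"
  shows "(\<lambda>p\<in>unit_cube. \<mu> p * f (S p)) \<in> carrier G_pos"
proof -
  obtain L where L: "finite L" "\<And>p. p \<in> unit_cube \<Longrightarrow> \<exists>l\<in>L. f p = int_affine l p"
    using f unfolding G_pos_iff mcnaughton_iff by blast
  have "(\<lambda>p\<in>unit_cube. \<mu> p * f (S p)) \<in> mcnaughton"
  proof (rule mcnaughtonI[where L = "(\<lambda>(l, A). row_affine (affine_row l v* A)) ` (L \<times> M)"])
    have "continuous_on unit_cube (\<lambda>p. f (S p))"
      using continuous_on_compose2[OF continuous_on_G_pos[OF f] S(1)] S(2) by blast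
    then show "continuous_on unit_cube (\<lambda>p\<in>unit_cube. \<mu> p * f (S p))"
      using continuous_on_cong_unit_cube[OF continuous_on_mult[OF \<mu>(1)]] by fastforce
    fix p :: "real ^ 'm" assume p: "p \<in> unit_cube"
    obtain A where A: "A \<in> M" "real_matrix A *v homog p = \<mu> p *\<^sub>R homog (S p)" using M(2)[OF p] by blast
    obtain l where l: "l \<in> L" "f (S p) = int_affine l (S p)" using L(2)[of "S p"] S(2) p by blast
    show "\<exists>l\<in>(\<lambda>(l, A). row_affine (affine_row l v* A)) ` (L \<times> M).
        (\<lambda>p\<in>unit_cube. \<mu> p * f (S p)) p = int_affine l p"
      using p l A int_affine_projective[OF A(2), of l]
      by (intro bexI[of _ "row_affine (affine_row l v* A)"]) auto
  qed (use L M in auto)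
  moreover have "\<mu> p * f (S p) \<ge> 0" if "p \<in> unit_cube" for p
  proof -
    have "f (S p) \<ge> 0" using f S(2) that by (auto simp: G_pos_iff)
    then show ?thesis using \<mu>(2)[OF that] by simp
  qed
  ultimately show ?thesis by (simp add: G_pos_iff)
qed

subsection \<open>Automorphisms from piecewise SL homeomorphisms\<close>

lemma interior_eq_empty_if_aff_dim_less:
  fixes C :: "(real ^ 'm::finite) set"
  assumes "aff_dim C \<noteq> int CARD('m)"
  shows "interior C = {}"
  using assms aff_dim_nonempty_interior[of C] by auto

lemma unit_cube_subset_if_interior_subset:
  assumes "closed F" "interior unit_cube \<subseteq> F"
  shows "(unit_cube :: (real ^ 'm::finite) set) \<subseteq> F"
proof -
  have "(unit_cube :: (real ^ 'm) set) = closure (interior unit_cube)"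
  proof -
    have "(1/2 :: real) *\<^sub>R 1 \<in> box 0 (1 :: real ^ 'm)" by (simp add: mem_box_cart)
    then have "box 0 (1 :: real ^ 'm) \<noteq> {}" by blast
    then show ?thesis by (simp add: closure_box)
  qed
  also have "\<dots> \<subseteq> F" using assms by (simp add: closure_minimal)
  finally show ?thesis .
qed

text \<open>Finitely many cells of lower dimension have a union with empty interior, so the closed
  union of the full cells contains the interior of the cube and hence the cube.\<close>

lemma full_cells_cover:
  fixes K :: "(real ^ 'm::finite) set set"
  assumes K: "finite K" "\<forall>C\<in>K. closed C" "\<Union>K = unit_cube" and p: "p \<in> unit_cube"
  shows "\<exists>C\<in>K. aff_dim C = int CARD('m) \<and> p \<in> C"
proof -
  define F where "F = \<Union>{C \<in> K. aff_dim C = int CARD('m)}"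
  define L where "L = \<Union>{C \<in> K. aff_dim C \<noteq> int CARD('m)}"
  have "closed F" unfolding F_def using K by (intro closed_Union) auto
  have "interior L = {}"
    unfolding L_def
  proof (rule interior_finite_Union_empty)
    show "interior C = {}" if "C \<in> {C \<in> K. aff_dim C \<noteq> int CARD('m)}" for C
      using that by (intro interior_eq_empty_if_aff_dim_less) auto
  qed (use K in auto)
  have "interior unit_cube - F \<subseteq> L"
  proof
    fix x assume x: "x \<in> interior unit_cube - F"
    then have "x \<in> \<Union>K" using K(3) interior_subset by blast
    with x show "x \<in> L" unfolding F_def L_def by blast
  qed
  moreover have "open (interior unit_cube - F)" by (rule open_Diff[OF open_interior \<open>closed F\<close>])
  ultimately have "interior unit_cube - F \<subseteq> interior L" by (rule interior_maximal)
  with \<open>interior L = {}\<close> have "interior unit_cube \<subseteq> F" by blast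
  from unit_cube_subset_if_interior_subset[OF \<open>closed F\<close> this] p show ?thesis by (auto simp: F_def)
qed

lemma int_affine_inner: "int_affine l p = (\<chi> i. of_int (fst l $ i)) \<bullet> p + of_int (snd l)"
  by (simp add: int_affine_def inner_vec_def)

lemma int_affine_eq_on_hull:
  assumes "\<And>v. v \<in> V \<Longrightarrow> int_affine l v = int_affine l' v" "p \<in> convex hull V"
  shows "int_affine l p = int_affine l' p"
proof -
  have "{x. int_affine (l - l') x = 0} = {x. (\<chi> i. of_int (fst (l - l') $ i)) \<bullet> x = - of_int (snd (l - l'))}"
    unfolding int_affine_inner by auto
  then have "convex {x. int_affine (l - l') x = 0}"
    using convex_hyperplane by metis
  then have "convex hull V \<subseteq> {x. int_affine (l - l') x = 0}"
    using assms(1) by (intro hull_minimal) (auto simp: int_affine_diff)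
  then show ?thesis using assms(2) by (auto simp: int_affine_diff)
qed

lemma piecewise_SL_factor:
  fixes S :: "real ^ 'm::finite \<Rightarrow> real ^ 'm" and A :: "(real ^ 'm) set \<Rightarrow> int ^ 'm option ^ 'm option"
  assumes K: "rational_cell_complex K" "\<Union>K = unit_cube"
    and A: "\<And>C. C \<in> K \<Longrightarrow> aff_dim C = int CARD('m) \<Longrightarrow> det (A C) = 1"
      "\<And>C p. C \<in> K \<Longrightarrow> aff_dim C = int CARD('m) \<Longrightarrow> p \<in> C \<Longrightarrow>
         \<exists>c>0. real_matrix (A C) *v homog p = c *\<^sub>R homog (S p)"
  obtains \<mu> where "continuous_on unit_cube \<mu>" "\<And>p. p \<in> unit_cube \<Longrightarrow> \<mu> p > 0"
    "\<And>C p. C \<in> K \<Longrightarrow> aff_dim C = int CARD('m) \<Longrightarrow> p \<in> C \<Longrightarrow>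
       real_matrix (A C) *v homog p = \<mu> p *\<^sub>R homog (S p)"
proof -
  let ?m = "int CARD('m)"
  have fin: "finite K" and poly: "\<And>C. C \<in> K \<Longrightarrow> polytope C"
    and rat: "\<And>C v i. C \<in> K \<Longrightarrow> v extreme_point_of C \<Longrightarrow> v $ i \<in> \<rat>"
    and face: "\<And>C F. C \<in> K \<Longrightarrow> F face_of C \<Longrightarrow> F \<in> K"
    and inter: "\<And>C D. C \<in> K \<Longrightarrow> D \<in> K \<Longrightarrow> (C \<inter> D) face_of C"
    using K(1) by (auto simp: rational_cell_complex_def)
  have closed: "\<forall>C\<in>K. closed C" using poly polytope_imp_closed by blast
  \<comment> \<open>The last coordinate of \<open>homog (S p)\<close> is 1, so the positive factor
    must be the last row of \<open>A C\<close> applied to \<open>homog p\<close>.\<close>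
  define fc where "fc C p = int_affine (row_affine (A C $ None)) p" for C p
  have fc: "fc C p > 0 \<and> real_matrix (A C) *v homog p = fc C p *\<^sub>R homog (S p)"
    if C: "C \<in> K" "aff_dim C = ?m" "p \<in> C" for C p
  proof -
    obtain c where c: "c > 0" "real_matrix (A C) *v homog p = c *\<^sub>R homog (S p)" using A(2)[OF C] by blast
    moreover have "fc C p = c"
      using arg_cong[OF c(2), of "\<lambda>v. v $ None"] by (simp add: fc_def real_matrix_mult_homog)
    ultimately show ?thesis by simp
  qed
  have eq: "fc C p = fc C' p"
    if C: "C \<in> K" "aff_dim C = ?m" "p \<in> C" and C': "C' \<in> K" "aff_dim C' = ?m" "p \<in> C'" for C C' p
  proof -
    have E: "C \<inter> C' \<in> K" using face[OF C(1) inter[OF C(1) C'(1)]] .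
    \<comment> \<open>The common face is the hull of its vertices, which are rational; two affine
      functions that agree there agree on the face.\<close>
    then have "p \<in> convex hull {v. v extreme_point_of (C \<inter> C')}"
      using Krein_Milman_Minkowski[of "C \<inter> C'"] poly[OF E] C(3) C'(3)
        polytope_imp_compact polytope_imp_convex by blast
    then show ?thesis
      unfolding fc_def
    proof (rule int_affine_eq_on_hull[rotated])
      fix v assume "v \<in> {v. v extreme_point_of (C \<inter> C')}"
      then have v: "v extreme_point_of (C \<inter> C')" by simp
      then have vC: "v \<in> C" "v \<in> C'" by (auto simp: extreme_point_of_def)
      have "fc C v = fc C' v"
        by (rule unimodular_factor_unique_rational[OF A(1)[OF C(1,2)] A(1)[OF C'(1,2)] rat[OF E v]])
          (use fc C C' vC in auto)
      then show "int_affine (row_affine (A C $ None)) v = int_affine (row_affine (A C' $ None)) v"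
        by (simp add: fc_def)
    qed
  qed
  \<comment> \<open>By \<open>eq\<close> the choice of the cell does not affect the value.\<close>
  define \<mu> where "\<mu> p = fc (SOME C. C \<in> K \<and> aff_dim C = ?m \<and> p \<in> C) p" for p
  have \<mu>: "\<mu> p = fc C p" if C: "C \<in> K" "aff_dim C = ?m" "p \<in> C" for C p
  proof -
    have "(SOME C. C \<in> K \<and> aff_dim C = ?m \<and> p \<in> C) \<in> K \<and> aff_dim (SOME C. C \<in> K \<and> aff_dim C = ?m \<and> p \<in> C) = ?m
        \<and> p \<in> (SOME C. C \<in> K \<and> aff_dim C = ?m \<and> p \<in> C)"
      by (rule someI[of _ C]) (use C in auto)
    then show ?thesis unfolding \<mu>_def by (intro eq C) auto
  qed
  let ?K = "{C \<in> K. aff_dim C = ?m}"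
  have cover: "unit_cube = (\<Union>C\<in>?K. C)"
    using full_cells_cover[OF fin closed K(2)] K(2) by auto
  have "continuous_on (\<Union>C\<in>?K. C) \<mu>"
  proof (rule continuous_on_closed_Union)
    fix C assume C: "C \<in> ?K"
    have "continuous_on C (fc C)" unfolding fc_def by (rule continuous_on_int_affine)
    then show "continuous_on C \<mu>"
      using continuous_on_cong[OF refl, of C \<mu> "fc C"] \<mu> C by auto
  qed (use fin closed in auto)
  moreover have "\<mu> p > 0" if "p \<in> unit_cube" for p
    using full_cells_cover[OF fin closed K(2) that] \<mu> fc by auto
  ultimately show ?thesis
    using that[of \<mu>] cover \<mu> fc by metis
qed

lemma piecewise_SL_is_dual_map:
  fixes S :: "real ^ 'm::finite \<Rightarrow> real ^ 'm"
  assumes "piecewise_SL_homeomorphism S"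
  obtains \<sigma> where "\<sigma> \<in> hoop_auto G_pos" "\<And>p. p \<in> unit_cube \<Longrightarrow> dual_map \<sigma> p = S p"
proof -
  let ?m = "int CARD('m)" and ?G = "carrier G_pos :: (real ^ 'm \<Rightarrow> real) set"
  obtain T where hom: "homeomorphism unit_cube unit_cube S T"
    using assms unfolding piecewise_SL_homeomorphism_def by blast
  obtain K and A :: "(real ^ 'm) set \<Rightarrow> int ^ 'm option ^ 'm option"
    where K: "rational_cell_complex K" "\<Union>K = unit_cube"
    and A': "\<forall>C\<in>K. aff_dim C = ?m \<longrightarrow> det (A C) = 1 \<and>
      (\<forall>p\<in>C. \<exists>c>0. real_matrix (A C) *v homog p = c *\<^sub>R homog (S p))"
    using assms unfolding piecewise_SL_homeomorphism_def by blast
  have A: "\<And>C. C \<in> K \<Longrightarrow> aff_dim C = ?m \<Longrightarrow> det (A C) = 1"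
      "\<And>C p. C \<in> K \<Longrightarrow> aff_dim C = ?m \<Longrightarrow> p \<in> C \<Longrightarrow>
         \<exists>c>0. real_matrix (A C) *v homog p = c *\<^sub>R homog (S p)"
    using A' by blast+
  obtain \<mu> where \<mu>: "continuous_on unit_cube \<mu>" "\<And>p. p \<in> unit_cube \<Longrightarrow> \<mu> p > 0"
    "\<And>C p. C \<in> K \<Longrightarrow> aff_dim C = ?m \<Longrightarrow> p \<in> C \<Longrightarrow> real_matrix (A C) *v homog p = \<mu> p *\<^sub>R homog (S p)"
    using piecewise_SL_factor[OF K, of A S, OF A] by blast
  have fin: "finite K" and closed: "\<forall>C\<in>K. closed C"
    using K(1) polytope_imp_closed by (auto simp: rational_cell_complex_def)
  note cover = full_cells_cover[OF fin closed K(2)]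
  have S: "continuous_on unit_cube S" "S \<in> unit_cube \<rightarrow> unit_cube" "\<And>p. p \<in> unit_cube \<Longrightarrow> T (S p) = p"
    and T: "continuous_on unit_cube T" "T \<in> unit_cube \<rightarrow> unit_cube" "\<And>p. p \<in> unit_cube \<Longrightarrow> S (T p) = p"
    using hom by (auto simp: homeomorphism_def)
  \<comment> \<open>\<open>B C\<close> is meaningful only for full cells; for the others it is an
    arbitrary matrix, which merely enlarges the finite set of candidates.\<close>
  define B where "B C = (SOME M. M ** A C = mat 1)" for C
  have B: "B C ** A C = mat 1" if "C \<in> K" "aff_dim C = ?m" for C
    unfolding B_def by (rule someI_ex) (use integer_matrix_inverse[OF A(1)[OF that]] in blast)
  \<comment> \<open>Pulling back along \<open>T\<close> must undo the factor, so it carries the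
    reciprocal taken at the preimage.\<close>
  define \<nu> where "\<nu> q = 1 / \<mu> (T q)" for q
  have \<nu>: "continuous_on unit_cube \<nu>" "\<And>q. q \<in> unit_cube \<Longrightarrow> \<nu> q > 0"
  proof -
    have "continuous_on unit_cube (\<lambda>q. \<mu> (T q))"
      using continuous_on_compose2[OF \<mu>(1) T(1)] T(2) by blast
    moreover have "\<mu> (T q) > 0" if "q \<in> unit_cube" for q using \<mu>(2) T(2) that by auto
    ultimately show "continuous_on unit_cube \<nu>" "\<And>q. q \<in> unit_cube \<Longrightarrow> \<nu> q > 0"
      unfolding \<nu>_def by (force intro!: continuous_on_divide continuous_on_const)+
  qed
  have \<sigma>G: "(\<lambda>p\<in>unit_cube. \<mu> p * f (S p)) \<in> ?G" if "f \<in> ?G" for f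
  proof (rule projective_pullback_in_G_pos[OF that S(1,2) \<mu>(1,2)])
    show "finite (A ` K)" using fin by simp
    show "\<exists>M\<in>A ` K. real_matrix M *v homog p = \<mu> p *\<^sub>R homog (S p)" if "p \<in> unit_cube" for p
      using cover[OF that] \<mu>(3) by blast
  qed
  have \<tau>G: "(\<lambda>q\<in>unit_cube. \<nu> q * f (T q)) \<in> ?G" if "f \<in> ?G" for f
  proof (rule projective_pullback_in_G_pos[OF that T(1,2) \<nu>])
    show "finite (B ` K)" using fin by simp
    fix q :: "real ^ 'm" assume q: "q \<in> unit_cube"
    have Tq: "T q \<in> unit_cube" using T(2) q by auto
    then obtain C where C: "C \<in> K" "aff_dim C = ?m" "T q \<in> C" using cover by blast
    have "homog (T q) = real_matrix (B C ** A C) *v homog (T q)"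
      by (simp add: B[OF C(1,2)] real_matrix_mat_1)
    also have "\<dots> = real_matrix (B C) *v (real_matrix (A C) *v homog (T q))"
      by (simp add: real_matrix_mult matrix_vector_mul_assoc)
    also have "\<dots> = \<mu> (T q) *\<^sub>R (real_matrix (B C) *v homog q)"
      using \<mu>(3)[OF C] T(3)[OF q] by (simp add: matrix_vector_mult_scaleR)
    finally have "real_matrix (B C) *v homog q = \<nu> q *\<^sub>R homog (T q)"
      using \<mu>(2)[OF Tq] by (simp add: \<nu>_def)
    then show "\<exists>M\<in>B ` K. real_matrix M *v homog q = \<nu> q *\<^sub>R homog (T q)"
      using C(1) by blast
  qed
  define \<sigma> where "\<sigma> = (\<lambda>f\<in>?G. \<lambda>p\<in>unit_cube. \<mu> p * f (S p))"
  have \<sigma>: "\<sigma> f p = \<mu> p * f (S p)" if "f \<in> ?G" "p \<in> unit_cube" for f p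
    using that by (simp add: \<sigma>_def)
  have \<sigma>c: "\<sigma> f \<in> ?G" if "f \<in> ?G" for f using \<sigma>G[OF that] that by (simp add: \<sigma>_def)
  have "bij_betw \<sigma> ?G ?G"
  proof (rule bij_betw_byWitness[where f' = "\<lambda>f. \<lambda>q\<in>unit_cube. \<nu> q * f (T q)"])
    show "\<forall>f\<in>?G. (\<lambda>q\<in>unit_cube. \<nu> q * \<sigma> f (T q)) = f"
    proof
      fix f assume f: "f \<in> ?G"
      show "(\<lambda>q\<in>unit_cube. \<nu> q * \<sigma> f (T q)) = f"
      proof (rule G_pos_eqI[OF \<tau>G[OF \<sigma>c[OF f]] f])
        fix q :: "real ^ 'm" assume q: "q \<in> unit_cube"
        then have "T q \<in> unit_cube" using T(2) by auto
        then show "(\<lambda>q\<in>unit_cube. \<nu> q * \<sigma> f (T q)) q = f q"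
          using q \<mu>(2)[of "T q"] by (simp add: \<sigma> f \<nu>_def T(3))
      qed
    qed
    show "\<forall>f\<in>?G. \<sigma> (\<lambda>q\<in>unit_cube. \<nu> q * f (T q)) = f"
    proof
      fix f assume f: "f \<in> ?G"
      show "\<sigma> (\<lambda>q\<in>unit_cube. \<nu> q * f (T q)) = f"
      proof (rule G_pos_eqI[OF \<sigma>c[OF \<tau>G[OF f]] f])
        fix p :: "real ^ 'm" assume p: "p \<in> unit_cube"
        then have "S p \<in> unit_cube" using S(2) by auto
        then show "\<sigma> (\<lambda>q\<in>unit_cube. \<nu> q * f (T q)) p = f p"
          unfolding \<sigma>[OF \<tau>G[OF f] p] using p \<mu>(2)[OF p] by (simp add: \<nu>_def S(3))
      qed
    qed
  qed (use \<sigma>c \<tau>G in auto)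
  then have "\<sigma> \<in> Bij ?G" by (simp add: Bij_def \<sigma>_def)
  moreover have "\<sigma> (hoop_plus G_pos f g) = hoop_plus G_pos (\<sigma> f) (\<sigma> g)" if "f \<in> ?G" "g \<in> ?G" for f g
  proof (rule G_pos_eqI)
    fix p :: "real ^ 'm" assume p: "p \<in> unit_cube"
    then have "S p \<in> unit_cube" using S(2) by auto
    with p that show "\<sigma> (hoop_plus G_pos f g) p = hoop_plus G_pos (\<sigma> f) (\<sigma> g) p"
      by (simp add: \<sigma> hoop_plus_G_pos algebra_simps)
  qed (use that \<sigma>c in auto)
  moreover have "\<sigma> (hoop_monus G_pos f g) = hoop_monus G_pos (\<sigma> f) (\<sigma> g)" if "f \<in> ?G" "g \<in> ?G" for f g
  proof (rule G_pos_eqI)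
    fix p :: "real ^ 'm" assume p: "p \<in> unit_cube"
    then have "S p \<in> unit_cube" using S(2) by auto
    with p that have "\<sigma> (hoop_monus G_pos f g) p = \<mu> p * max 0 (f (S p) - g (S p))"
      by (simp add: \<sigma> hoop_monus_G_pos)
    also have "\<dots> = max 0 (\<mu> p * f (S p) - \<mu> p * g (S p))"
      using \<mu>(2)[OF p] by (simp add: max_mult_distrib_left right_diff_distrib)
    also have "\<dots> = hoop_monus G_pos (\<sigma> f) (\<sigma> g) p"
      using p that by (simp add: \<sigma> hoop_monus_G_pos)
    finally show "\<sigma> (hoop_monus G_pos f g) p = hoop_monus G_pos (\<sigma> f) (\<sigma> g) p" .
  qed (use that \<sigma>c in auto)
  moreover have "\<sigma> (hoop_zero G_pos) = hoop_zero G_pos"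
  proof (rule G_pos_eqI)
    fix p :: "real ^ 'm" assume p: "p \<in> unit_cube"
    then have "S p \<in> unit_cube" using S(2) by auto
    with p show "\<sigma> (hoop_zero G_pos) p = hoop_zero G_pos p"
      by (simp add: \<sigma> hoop_zero_G_pos)
  qed (use \<sigma>c in auto)
  ultimately have "\<sigma> \<in> hoop_auto G_pos" by (simp add: hoop_auto_def)
  moreover have "dual_map \<sigma> p = S p" if p: "p \<in> unit_cube" for p
  proof -
    have "S p \<in> unit_cube" using S(2) p by auto
    then show ?thesis using p \<mu>(2)[OF p] by (simp add: dual_map_def \<sigma> vec_eq_iff)
  qed
  ultimately show ?thesis by (rule that)
qed

subsection \<open>Rational arrangements of hyperplanes\<close>

lemma int_affine_convex_comb: "int_affine l ((1 - u) *\<^sub>R x + u *\<^sub>R y) = (1 - u) * int_affine l x + u * int_affine l y"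
  by (simp add: int_affine_inner inner_add_right algebra_simps)

lemma int_affine_toward: "int_affine l (x + e *\<^sub>R (y - x)) = int_affine l x + e * (int_affine l y - int_affine l x)"
  by (simp add: int_affine_inner inner_add_right inner_diff_right algebra_simps)

text \<open>A form in both \<open>P\<close> and \<open>N\<close> imposes an equation, so the
  nonempty faces of a cell are again such sets with the same union of \<open>P\<close> and
  \<open>N\<close>.\<close>

definition arrangement_cell ::
  "((int ^ 'm::finite) \<times> int) set \<Rightarrow> ((int ^ 'm) \<times> int) set \<Rightarrow> (real ^ 'm) set" where
  "arrangement_cell P N = {x. (\<forall>l\<in>P. int_affine l x \<ge> 0) \<and> (\<forall>l\<in>N. int_affine l x \<le> 0)}"

lemma arrangement_cell_Int:
  "arrangement_cell P N \<inter> arrangement_cell P' N' = arrangement_cell (P \<union> P') (N \<union> N')"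
  by (auto simp: arrangement_cell_def)

lemma polyhedron_arrangement_cell:
  assumes "finite P" "finite N"
  shows "polyhedron (arrangement_cell P N)"
proof -
  have "arrangement_cell P N = \<Inter> ((\<lambda>l. {x. int_affine l x \<ge> 0}) ` P) \<inter> \<Inter> ((\<lambda>l. {x. int_affine l x \<le> 0}) ` N)"
    by (auto simp: arrangement_cell_def)
  moreover have "polyhedron {x. int_affine l x \<ge> 0}" "polyhedron {x. int_affine l x \<le> 0}" for l :: "(int ^ 'a) \<times> int"
  proof -
    let ?a = "\<chi> i. of_int (fst l $ i) :: real ^ 'a"
    have "{x. int_affine l x \<ge> 0} = {x. ?a \<bullet> x \<ge> - of_int (snd l)}"
      "{x. int_affine l x \<le> 0} = {x. ?a \<bullet> x \<le> - of_int (snd l)}"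
      unfolding int_affine_inner by auto
    then show "polyhedron {x. int_affine l x \<ge> 0}" "polyhedron {x. int_affine l x \<le> 0}"
      by (simp_all add: polyhedron_halfspace_le polyhedron_halfspace_ge)
  qed
  ultimately show ?thesis
    using assms by (auto intro!: polyhedron_Int polyhedron_Inter)
qed

text \<open>For a short while the nonvanishing forms keep their signs, and the vanishing ones stay 0
  by the assumption on \<open>y\<close>.\<close>

lemma arrangement_cell_segment:
  assumes "finite H" "P \<subseteq> H" "N \<subseteq> H" and x: "x \<in> arrangement_cell P N"
    and y: "\<And>l. l \<in> H \<Longrightarrow> int_affine l x = 0 \<Longrightarrow> int_affine l y = 0"
  obtains e where "e > 0" "x + e *\<^sub>R (y - x) \<in> arrangement_cell P N"
proof -
  have "\<forall>\<^sub>F e in at_right 0. \<forall>l\<in>H. sgn (int_affine l (x + e *\<^sub>R (y - x))) = sgn (int_affine l x)"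
  proof (rule eventually_ball_finite[OF \<open>finite H\<close>], rule ballI)
    fix l assume l: "l \<in> H"
    have "((\<lambda>e. int_affine l x + e * (int_affine l y - int_affine l x)) \<longlongrightarrow>
        int_affine l x + 0 * (int_affine l y - int_affine l x)) (at_right 0)"
      by (intro tendsto_intros)
    then have lim: "((\<lambda>e. int_affine l (x + e *\<^sub>R (y - x))) \<longlongrightarrow> int_affine l x) (at_right 0)"
      by (simp add: int_affine_toward)
    consider "int_affine l x = 0" | "int_affine l x > 0" | "int_affine l x < 0" by linarith
    then show "\<forall>\<^sub>F e in at_right 0. sgn (int_affine l (x + e *\<^sub>R (y - x))) = sgn (int_affine l x)"
    proof cases
      case 1
      then show ?thesis using y[OF l] by (simp add: int_affine_toward)
    next
      case 2
      from order_tendstoD(1)[OF lim 2] show ?thesis by eventually_elim (use 2 in simp)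
    next
      case 3
      from order_tendstoD(2)[OF lim 3] show ?thesis by eventually_elim (use 3 in simp)
    qed
  qed
  moreover have "\<forall>\<^sub>F e::real in at_right 0. e > 0" by (rule eventually_at_right_less)
  ultimately have "\<forall>\<^sub>F e in at_right 0. e > 0 \<and> (\<forall>l\<in>H. sgn (int_affine l (x + e *\<^sub>R (y - x))) = sgn (int_affine l x))"
    by eventually_elim auto
  from eventually_happens'[OF trivial_limit_at_right_real this]
  obtain e where e: "e > 0" "\<And>l. l \<in> H \<Longrightarrow> sgn (int_affine l (x + e *\<^sub>R (y - x))) = sgn (int_affine l x)"
    by blast
  have "x + e *\<^sub>R (y - x) \<in> arrangement_cell P N"
    unfolding arrangement_cell_def
  proof (intro CollectI conjI ballI)
    fix l assume l: "l \<in> P"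
    then have "sgn (int_affine l x) \<ge> 0" using x by (auto simp: arrangement_cell_def)
    moreover have "l \<in> H" using l assms(2) by blast
    ultimately have "sgn (int_affine l (x + e *\<^sub>R (y - x))) \<ge> 0" by (simp only: e(2))
    then show "int_affine l (x + e *\<^sub>R (y - x)) \<ge> 0" by simp
  next
    fix l assume l: "l \<in> N"
    then have "sgn (int_affine l x) \<le> 0" using x by (auto simp: arrangement_cell_def)
    moreover have "l \<in> H" using l assms(3) by blast
    ultimately have "sgn (int_affine l (x + e *\<^sub>R (y - x))) \<le> 0" by (simp only: e(2))
    then show "int_affine l (x + e *\<^sub>R (y - x)) \<le> 0" by simp
  qed
  with e(1) show ?thesis by (rule that)
qed

text \<open>Each added form has constant sign on the larger cell and vanishes on the smaller one, so
  it is a supporting hyperplane: a proper convex combination of two values of one sign is 0 only if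
  both are.\<close>

lemma arrangement_cell_face:
  assumes "P \<union> N = H" "P \<subseteq> P'" "N \<subseteq> N'" "P' \<union> N' \<subseteq> H"
  shows "arrangement_cell P' N' face_of arrangement_cell P N"
  unfolding face_of_def
proof (intro conjI ballI impI)
  show "arrangement_cell P' N' \<subseteq> arrangement_cell P N"
    using assms by (auto simp: arrangement_cell_def)
  show "convex (arrangement_cell P' N')"
    unfolding convex_alt by (auto simp: arrangement_cell_def int_affine_convex_comb
        intro!: add_nonneg_nonneg add_nonpos_nonpos mult_nonneg_nonneg mult_nonneg_nonpos)
  fix a b x
  assume a: "a \<in> arrangement_cell P N" and b: "b \<in> arrangement_cell P N"
    and x: "x \<in> arrangement_cell P' N'" and seg: "x \<in> open_segment a b"
  obtain u where u: "0 < u" "u < 1" "x = (1 - u) *\<^sub>R a + u *\<^sub>R b"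
    using seg by (auto simp: in_segment)
  have "int_affine l a \<ge> 0 \<and> int_affine l b \<ge> 0" if "l \<in> P'" for l
  proof (cases "l \<in> P")
    case True
    then show ?thesis using a b by (auto simp: arrangement_cell_def)
  next
    case False
    then have "l \<in> N" using assms that by auto
    then have le: "int_affine l a \<le> 0" "int_affine l b \<le> 0" using a b by (auto simp: arrangement_cell_def)
    have "(1 - u) * int_affine l a + u * int_affine l b \<ge> 0"
      using x that u(3) by (auto simp: arrangement_cell_def simp flip: int_affine_convex_comb)
    moreover have "(1 - u) * int_affine l a \<le> 0" "u * int_affine l b \<le> 0"
      using le u by (auto intro: mult_nonneg_nonpos)
    ultimately have "(1 - u) * int_affine l a = 0" "u * int_affine l b = 0" by linarith+
    then show ?thesis using u by simp
  qed
  moreover have "int_affine l a \<le> 0 \<and> int_affine l b \<le> 0" if "l \<in> N'" for l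
  proof (cases "l \<in> N")
    case True
    then show ?thesis using a b by (auto simp: arrangement_cell_def)
  next
    case False
    then have "l \<in> P" using assms that by auto
    then have ge: "int_affine l a \<ge> 0" "int_affine l b \<ge> 0" using a b by (auto simp: arrangement_cell_def)
    have "(1 - u) * int_affine l a + u * int_affine l b \<le> 0"
      using x that u(3) by (auto simp: arrangement_cell_def simp flip: int_affine_convex_comb)
    moreover have "(1 - u) * int_affine l a \<ge> 0" "u * int_affine l b \<ge> 0"
      using ge u by (auto intro: mult_nonneg_nonneg)
    ultimately have "(1 - u) * int_affine l a = 0" "u * int_affine l b = 0" by linarith+
    then show ?thesis using u by simp
  qed
  ultimately show "a \<in> arrangement_cell P' N'" "b \<in> arrangement_cell P' N'"
    by (auto simp: arrangement_cell_def)
qed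

text \<open>A face meeting the relative interior of \<open>F\<close> contains \<open>F\<close>.
  Conversely, a segment from \<open>y\<close> to \<open>x\<close> can be prolonged beyond
  \<open>x\<close> inside the cell, and the face property then puts \<open>y\<close> in
  \<open>F\<close>.\<close>

lemma face_of_arrangement_cell:
  assumes H: "finite H" "P \<union> N = H" and F: "F face_of arrangement_cell P N" "x \<in> rel_interior F"
  shows "F = arrangement_cell (P \<union> {l \<in> H. int_affine l x = 0}) (N \<union> {l \<in> H. int_affine l x = 0})"
    (is "F = arrangement_cell ?P ?N")
proof
  have xF: "x \<in> F" using F(2) rel_interior_subset by blast
  have sub: "F \<subseteq> arrangement_cell P N" using F(1) face_of_imp_subset by blast
  have x: "x \<in> arrangement_cell ?P ?N"
    using xF sub by (auto simp: arrangement_cell_def)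
  have face: "arrangement_cell ?P ?N face_of arrangement_cell P N"
    by (rule arrangement_cell_face[OF H(2)]) (use H(2) in auto)
  show "F \<subseteq> arrangement_cell ?P ?N"
    by (rule subset_of_face_of[OF face sub]) (use x F(2) in auto)
  show "arrangement_cell ?P ?N \<subseteq> F"
  proof
    fix y assume y: "y \<in> arrangement_cell ?P ?N"
    \<comment> \<open>\<open>2 *\<^sub>R x - y\<close> is the mirror image of \<open>y\<close> in
      \<open>x\<close>: moving from \<open>x\<close> towards it means moving away from
      \<open>y\<close>.\<close>
    have "int_affine l (2 *\<^sub>R x - y) = 0" if "l \<in> H" "int_affine l x = 0" for l
    proof -
      have "int_affine l y = 0" using y that by (force simp: arrangement_cell_def)
      moreover have "2 *\<^sub>R x - y = (1 - (- 1)) *\<^sub>R x + (- 1) *\<^sub>R y" by simp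
      ultimately show ?thesis using that(2) int_affine_convex_comb[of l "- 1" x y] by simp
    qed
    then obtain e where e: "e > 0" "x + e *\<^sub>R ((2 *\<^sub>R x - y) - x) \<in> arrangement_cell P N"
      using arrangement_cell_segment[OF H(1), of P N x "2 *\<^sub>R x - y"] H(2) sub xF by blast
    define z where "z = x + e *\<^sub>R (x - y)"
    have z: "z \<in> arrangement_cell P N" using e(2) by (simp add: z_def scaleR_2)
    show "y \<in> F"
    proof (cases "y = x")
      case False
      \<comment> \<open>The weights come from solving z = x + e (x - y) for x.\<close>
      have xyz: "x = (1 - 1 / (1 + e)) *\<^sub>R y + (1 / (1 + e)) *\<^sub>R z"
      proof -
        have eq: "(1 - 1 / (1 + e)) *\<^sub>R y + (1 / (1 + e)) *\<^sub>R z =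
          (1 - 1 / (1 + e) - e / (1 + e)) *\<^sub>R y + (1 / (1 + e) + e / (1 + e)) *\<^sub>R x"
          by (simp add: z_def algebra_simps)
        have "1 - 1 / (1 + e) - e / (1 + e) = 0" "1 / (1 + e) + e / (1 + e) = 1"
          using e(1) by (simp_all add: field_simps)
        then show ?thesis unfolding eq by simp
      qed
      have "z \<noteq> y"
      proof
        assume "z = y"
        then have "(1 + e) *\<^sub>R (x - y) = 0" by (simp add: z_def algebra_simps)
        with e(1) False show False by simp
      qed
      then have "x \<in> open_segment y z"
        using xyz e(1) by (auto simp: in_segment intro!: exI[of _ "1 / (1 + e)"])
      moreover have "y \<in> arrangement_cell P N" using y face face_of_imp_subset by blast
      ultimately show ?thesis using face_ofD[OF F(1) _ _ z xF] by blast
    qed (use xF in simp)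
  qed
qed

text \<open>A \<open>\<rat>\<close>-linear retraction of \<open>\<real>\<close> onto \<open>\<rat>\<close> maps real solutions of an integer system of linear
  equations to rational solutions; hence a unique solution is rational.\<close>

lemma rat_linear_retraction:
  obtains \<pi> :: "real \<Rightarrow> rat" where "\<pi> 1 = 1" "\<And>x y. \<pi> (x + y) = \<pi> x + \<pi> y" "\<And>q x. \<pi> (of_rat q * x) = q * \<pi> x"
proof -
  interpret vector_space_pair "\<lambda>(q::rat) (x::real). of_rat q * x" "\<lambda>(q::rat) (x::rat). q * x"
    by unfold_locales (auto simp: algebra_simps of_rat_add of_rat_mult)
  \<comment> \<open>A basis of the reals over the rationals that contains 1 provides the
    map.\<close>
  have "vs1.independent {1}" by simp
  then obtain g where g: "Vector_Spaces.linear (\<lambda>q x. real_of_rat q * x) (*) g" "g 1 = (1 :: rat)"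
    using linear_independent_extend[of "{1}" "\<lambda>_. 1"] by auto
  then show ?thesis
    by (intro that[of g]) (auto simp: Vector_Spaces.linear_iff)
qed

lemma unique_int_affine_zero_rational:
  fixes v :: "real ^ 'm::finite"
  assumes v: "\<And>l. l \<in> Z \<Longrightarrow> int_affine l v = 0" and uniq: "\<And>y. (\<And>l. l \<in> Z \<Longrightarrow> int_affine l y = 0) \<Longrightarrow> y = v"
  shows "v $ i \<in> \<rat>"
proof -
  obtain \<pi> :: "real \<Rightarrow> rat" where \<pi>: "\<pi> 1 = 1" "\<And>x y. \<pi> (x + y) = \<pi> x + \<pi> y" "\<And>q x. \<pi> (of_rat q * x) = q * \<pi> x"
    using rat_linear_retraction by blast
  have \<pi>int: "\<pi> (of_int n * x) = of_int n * \<pi> x" for n x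
    using \<pi>(3)[of "of_int n" x] by simp
  have \<pi>of_int: "\<pi> (of_int n) = of_int n" for n
    using \<pi>int[of n 1] \<pi>(1) by simp
  have \<pi>0: "\<pi> 0 = 0" using \<pi>(2)[of 0 0] by simp
  have \<pi>sum: "\<pi> (sum f I) = (\<Sum>i\<in>I. \<pi> (f i))" if "finite I" for f and I :: "'m set"
    using that by induction (auto simp: \<pi>0 \<pi>(2))
  \<comment> \<open>\<open>?y\<close> solves the same equations as \<open>v\<close>, because
    \<open>\<pi>\<close> commutes with integer multiples and fixes the integer constants.\<close>
  let ?y = "(\<chi> i. of_rat (\<pi> (v $ i))) :: real ^ 'm"
  have "int_affine l ?y = 0" if "l \<in> Z" for l
  proof -
    have "0 = \<pi> ((\<Sum>i\<in>UNIV. of_int (fst l $ i) * v $ i) + of_int (snd l))"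
      using v[OF that] by (simp add: int_affine_def \<pi>0)
    also have "\<dots> = (\<Sum>i\<in>UNIV. of_int (fst l $ i) * \<pi> (v $ i)) + of_int (snd l)"
      by (simp only: \<pi>(2) \<pi>sum[OF finite_class.finite_UNIV] \<pi>int \<pi>of_int)
    finally have "(0 :: real) = of_rat ((\<Sum>i\<in>UNIV. of_int (fst l $ i) * \<pi> (v $ i)) + of_int (snd l))" by simp
    then show ?thesis by (simp add: int_affine_def of_rat_add of_rat_sum of_rat_mult)
  qed
  then have "?y = v" by (rule uniq)
  then have "v $ i = of_rat (\<pi> (v $ i))" by (metis vec_lambda_beta)
  then show ?thesis by (metis Rats_of_rat)
qed

text \<open>Every form gets a weak sign or both signs, which yields cells of all dimensions;
  containment in the cube makes them bounded.\<close>

definition cube_arrangement :: "((int ^ 'm::finite) \<times> int) set \<Rightarrow> (real ^ 'm) set set" where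
  "cube_arrangement H = {arrangement_cell P N | P N. P \<union> N = H \<and> arrangement_cell P N \<subseteq> unit_cube}"

lemma rational_cell_complex_cube_arrangement:
  fixes H :: "((int ^ 'm::finite) \<times> int) set"
  assumes H: "finite H" "\<And>i. (axis i 1, 0) \<in> H" "\<And>i. (axis i 1, - 1) \<in> H"
  shows "rational_cell_complex (cube_arrangement H)" "\<Union> (cube_arrangement H) = unit_cube"
proof -
  show "\<Union> (cube_arrangement H) = unit_cube"
  proof
    show "unit_cube \<subseteq> \<Union> (cube_arrangement H)"
    proof
      fix p :: "real ^ 'm" assume p: "p \<in> unit_cube"
      let ?P = "{l \<in> H. int_affine l p \<ge> 0}" and ?N = "{l \<in> H. int_affine l p \<le> 0}"
      \<comment> \<open>The facet forms of the cube belong to \<open>H\<close>, so their signs at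
        \<open>p\<close> confine the cell to the cube.\<close>
      have "x $ i \<ge> 0 \<and> x $ i \<le> 1" if "x \<in> arrangement_cell ?P ?N" for x i
      proof -
        have "(axis i 1, 0) \<in> ?P" "(axis i 1, - 1) \<in> ?N"
          using H p by (auto simp: int_affine_axis mem_box_cart)
        then have "int_affine (axis i 1, 0) x \<ge> 0" "int_affine (axis i 1, - 1) x \<le> 0"
          using that unfolding arrangement_cell_def by blast+
        then show ?thesis by (simp add: int_affine_axis)
      qed
      then have "arrangement_cell ?P ?N \<subseteq> unit_cube" by (auto simp: mem_box_cart)
      moreover have "?P \<union> ?N = H" by auto
      moreover have "p \<in> arrangement_cell ?P ?N" by (auto simp: arrangement_cell_def)
      ultimately show "p \<in> \<Union> (cube_arrangement H)" unfolding cube_arrangement_def by blast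
    qed
  qed (auto simp: cube_arrangement_def)
  have "cube_arrangement H \<subseteq> (\<lambda>(P, N). arrangement_cell P N) ` (Pow H \<times> Pow H)"
    by (auto simp: cube_arrangement_def)
  then have fin: "finite (cube_arrangement H)"
    using H(1) by (meson finite_Pow_iff finite_SigmaI finite_imageI finite_subset)
  have poly: "polytope C" if "C \<in> cube_arrangement H" for C
  proof -
    obtain P N where C: "C = arrangement_cell P N" "P \<union> N = H" "C \<subseteq> unit_cube"
      using \<open>C \<in> cube_arrangement H\<close> by (auto simp: cube_arrangement_def)
    have "polyhedron C" unfolding C(1) using C(2) H(1) by (intro polyhedron_arrangement_cell) auto
    then show ?thesis
      using bounded_subset[OF bounded_cbox C(3)] by (simp add: polytope_eq_bounded_polyhedron)
  qed
  have face: "F \<in> cube_arrangement H" if C: "C \<in> cube_arrangement H" and F: "F face_of C" for C F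
  proof (cases "F = {}")
    case True
    obtain i :: 'm where "True" by simp
    \<comment> \<open>Imposing all forms as equations requires \<open>x $ i\<close> to be 0 and 1 at
      once, so the empty face is a cell too.\<close>
    have "x \<notin> arrangement_cell H H" for x
    proof
      assume x: "x \<in> arrangement_cell H H"
      have "int_affine (axis i 1, 0) x \<le> 0" "int_affine (axis i 1, - 1) x \<ge> 0"
        using x H(2,3) unfolding arrangement_cell_def by blast+
      then show False by (simp add: int_affine_axis)
    qed
    then have "arrangement_cell H H = {}" by blast
    then show ?thesis using True by (auto simp: cube_arrangement_def intro!: exI[of _ H])
  next
    case False
    obtain P N where PN: "C = arrangement_cell P N" "P \<union> N = H" "C \<subseteq> unit_cube"
      using C by (auto simp: cube_arrangement_def)
    have "convex F" using F face_of_imp_convex by blast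
    then obtain x where x: "x \<in> rel_interior F" using False rel_interior_eq_empty by blast
    have "F = arrangement_cell (P \<union> {l \<in> H. int_affine l x = 0}) (N \<union> {l \<in> H. int_affine l x = 0})"
      by (rule face_of_arrangement_cell[OF H(1) PN(2) F[unfolded PN(1)] x])
    moreover have "(P \<union> {l \<in> H. int_affine l x = 0}) \<union> (N \<union> {l \<in> H. int_affine l x = 0}) = H"
      using PN(2) by auto
    moreover have "F \<subseteq> unit_cube" using face_of_imp_subset[OF F] PN(3) by blast
    ultimately show ?thesis unfolding cube_arrangement_def by blast
  qed
  have inter: "(C \<inter> D) face_of C" if "C \<in> cube_arrangement H" "D \<in> cube_arrangement H" for C D
  proof -
    obtain P N where C: "C = arrangement_cell P N" "P \<union> N = H"
      using \<open>C \<in> cube_arrangement H\<close> by (auto simp: cube_arrangement_def)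
    obtain P' N' where D: "D = arrangement_cell P' N'" "P' \<union> N' = H"
      using \<open>D \<in> cube_arrangement H\<close> by (auto simp: cube_arrangement_def)
    show ?thesis
      unfolding C(1) D(1) arrangement_cell_Int
      by (rule arrangement_cell_face[OF C(2)]) (use C(2) D(2) in auto)
  qed
  have rat: "v $ i \<in> \<rat>" if C: "C \<in> cube_arrangement H" and v: "v extreme_point_of C" for C v i
  proof -
    obtain P N where PN: "C = arrangement_cell P N" "P \<union> N = H"
      using C by (auto simp: cube_arrangement_def)
    let ?Z = "{l \<in> H. int_affine l v = 0}"
    have "{v} face_of arrangement_cell P N" using v PN(1) by (simp add: face_of_singleton)
    then have eq: "{v} = arrangement_cell (P \<union> ?Z) (N \<union> ?Z)"
      by (intro face_of_arrangement_cell[OF H(1) PN(2)]) auto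
    \<comment> \<open>If another point satisfied the equations tight at \<open>v\<close>, a small
      step towards it would stay in the face \<open>{v}\<close>.\<close>
    show ?thesis
    proof (rule unique_int_affine_zero_rational[of ?Z])
      fix y assume "\<And>l. l \<in> ?Z \<Longrightarrow> int_affine l y = 0"
      then obtain e where e: "e > 0" "v + e *\<^sub>R (y - v) \<in> arrangement_cell (P \<union> ?Z) (N \<union> ?Z)"
        using arrangement_cell_segment[OF H(1), of "P \<union> ?Z" "N \<union> ?Z" v y] PN(2) eq by blast
      then have "e *\<^sub>R (y - v) = 0" unfolding eq[symmetric] by simp
      then show "y = v" using e(1) by simp
    qed auto
  qed
  show "rational_cell_complex (cube_arrangement H)"
    unfolding rational_cell_complex_def
    using fin poly rat face inter by (metis Int_commute)
qed

subsection \<open>Dual maps are piecewise SL\<close>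

lemma affine_row_nth [simp]: "affine_row l $ Some i = fst l $ i" "affine_row l $ None = snd l"
  by (simp_all add: affine_row_def)

lemma row_affine_affine_row: "row_affine (affine_row l) = l"
  by (cases l) (simp add: row_affine_def vec_eq_iff)

lemma finite_matrices_rows: "finite R \<Longrightarrow> finite {A :: 'a ^ 'n::finite ^ 'k::finite. \<forall>i. A $ i \<in> R}"
proof -
  assume "finite R"
  then have "finite (UNIV \<rightarrow>\<^sub>E R :: ('k \<Rightarrow> 'a ^ 'n) set)" by (intro finite_PiE) auto
  moreover have "{A :: 'a ^ 'n ^ 'k. \<forall>i. A $ i \<in> R} \<subseteq> (\<lambda>f. \<chi> i. f i) ` (UNIV \<rightarrow>\<^sub>E R)"
  proof
    fix A :: "'a ^ 'n ^ 'k" assume "A \<in> {A. \<forall>i. A $ i \<in> R}"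
    then show "A \<in> (\<lambda>f. \<chi> i. f i) ` (UNIV \<rightarrow>\<^sub>E R)"
      by (intro image_eqI[of _ _ "($) A"]) auto
  qed
  ultimately show ?thesis by (meson finite_imageI finite_subset)
qed

definition homog_image ::
  "((real ^ 'm::finite \<Rightarrow> real) \<Rightarrow> real ^ 'm \<Rightarrow> real) \<Rightarrow> 'm option \<Rightarrow> real ^ 'm \<Rightarrow> real" where
  "homog_image \<sigma> i = (case i of None \<Rightarrow> \<sigma> one_fun | Some j \<Rightarrow> \<sigma> (proj_fun j))"

lemma homog_image_in_G_pos: "\<sigma> \<in> hoop_auto G_pos \<Longrightarrow> homog_image \<sigma> i \<in> carrier G_pos"
  by (auto simp: homog_image_def hoop_autoD(5) split: option.split)

lemma homog_image_eq:
  assumes "\<sigma> \<in> hoop_auto G_pos" "p \<in> unit_cube"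
  shows "homog_image \<sigma> i p = (\<sigma> one_fun p *\<^sub>R homog (dual_map \<sigma> p)) $ i"
  using hoop_auto_evaluation(2)[OF assms] by (cases i) (auto simp: homog_image_def dual_map_def)

lemma G_pos_common_pieces:
  fixes F :: "'k::finite \<Rightarrow> real ^ 'm::finite \<Rightarrow> real"
  assumes "\<And>i. F i \<in> carrier G_pos"
  obtains L where "finite L" "\<And>i p. p \<in> unit_cube \<Longrightarrow> \<exists>l\<in>L. F i p = int_affine l p"
proof -
  have "\<exists>L. finite L \<and> (\<forall>p\<in>unit_cube. \<exists>l\<in>L. F i p = int_affine l p)" for i
    using assms[of i] unfolding G_pos_iff mcnaughton_iff by blast
  then obtain L where L: "\<And>i. finite (L i)" "\<And>i p. p \<in> unit_cube \<Longrightarrow> \<exists>l\<in>L i. F i p = int_affine l p"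
    by metis
  show ?thesis
  proof (rule that[of "\<Union>i. L i"])
    show "\<exists>l\<in>\<Union>i. L i. F i p = int_affine l p" if "p \<in> unit_cube" for i p
      using L(2)[OF that, of i] by blast
  qed (use L(1) in auto)
qed

text \<open>Choosing a piece for each row independently gives finitely many matrices, one of which
  works at each point. This is all that is required of the inverse automorphism, so no cells are
  built for it.\<close>

lemma hoop_auto_finite_matrices:
  fixes \<sigma> :: "(real ^ 'm::finite \<Rightarrow> real) \<Rightarrow> (real ^ 'm \<Rightarrow> real)"
  assumes \<sigma>: "\<sigma> \<in> hoop_auto G_pos"
  obtains M where "finite M" "\<And>p. p \<in> unit_cube \<Longrightarrow> \<exists>A\<in>M. real_matrix A *v homog p = \<sigma> one_fun p *\<^sub>R homog (dual_map \<sigma> p)"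
proof -
  obtain L where L: "finite L" "\<And>i p. p \<in> unit_cube \<Longrightarrow> \<exists>l\<in>L. homog_image \<sigma> i p = int_affine l p"
    using G_pos_common_pieces[of "homog_image \<sigma>"] homog_image_in_G_pos[OF \<sigma>] by blast
  let ?M = "{A :: int ^ 'm option ^ 'm option. \<forall>i. A $ i \<in> affine_row ` L}"
  show ?thesis
  proof (rule that[of ?M])
    show "finite ?M" using L(1) by (intro finite_matrices_rows) auto
    fix p :: "real ^ 'm" assume p: "p \<in> unit_cube"
    obtain l where l: "\<And>i. l i \<in> L" "\<And>i. homog_image \<sigma> i p = int_affine (l i) p"
      using L(2)[OF p] by metis
    have "real_matrix (\<chi> i. affine_row (l i)) *v homog p = \<sigma> one_fun p *\<^sub>R homog (dual_map \<sigma> p)"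
      by (rule vec_eq_iff[THEN iffD2, OF allI])
        (simp only: real_matrix_mult_homog vec_lambda_beta row_affine_affine_row l(2)[symmetric] homog_image_eq[OF \<sigma> p])
    then show "\<exists>A\<in>?M. real_matrix A *v homog p = \<sigma> one_fun p *\<^sub>R homog (dual_map \<sigma> p)"
      using l(1) by (intro bexI[of _ "\<chi> i. affine_row (l i)"]) auto
  qed
qed

lemma int_affine_zero_interior:
  assumes "interior {p. int_affine l p = 0} \<noteq> {}"
  shows "l = 0"
proof -
  obtain p e where e: "e > 0" "ball p e \<subseteq> {p. int_affine l p = 0}"
    using assms by (meson ex_in_conv mem_interior)
  have p: "int_affine l p = 0" using e by (auto simp: subset_iff)
  have "fst l $ i = 0" for i
  proof -
    have "p + (e / 2) *\<^sub>R axis i 1 \<in> ball p e" using e(1) by (simp add: dist_norm norm_axis_1)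
    then have "int_affine l (p + (e / 2) *\<^sub>R axis i 1) = 0" using e(2) by blast
    moreover have "int_affine l (p + (e / 2) *\<^sub>R axis i 1) = int_affine l p + (e / 2) * of_int (fst l $ i)"
      by (simp add: int_affine_inner inner_add_right inner_axis)
    ultimately have "(e / 2) * of_int (fst l $ i) = 0" using p by simp
    then show ?thesis using e(1) by simp
  qed
  moreover from this have "snd l = 0" using p by (simp add: int_affine_def)
  ultimately show ?thesis by (simp add: prod_eq_iff vec_eq_iff)
qed

text \<open>\<open>M\<close> fixes \<open>homog p\<close> exactly and not only up to a factor, so
  its rows can be compared with those of the identity as affine forms.\<close>

lemma real_matrix_fixing_open_set:
  fixes M :: "int ^ 'm::finite option ^ 'm option"
  assumes "interior {p. real_matrix M *v homog p = homog p} \<noteq> {}"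
  shows "M = mat 1"
proof -
  have "row_affine (M $ i) = row_affine (mat 1 $ i)" for i
  proof -
    have "{p. real_matrix M *v homog p = homog p} \<subseteq> {p. int_affine (row_affine (M $ i) - row_affine (mat 1 $ i)) p = 0}"
    proof
      fix p :: "real ^ 'm" assume "p \<in> {p. real_matrix M *v homog p = homog p}"
      then have "(real_matrix M *v homog p) $ i = (real_matrix (mat 1) *v homog p) $ i"
        by (simp add: real_matrix_mat_1)
      then show "p \<in> {p. int_affine (row_affine (M $ i) - row_affine (mat 1 $ i)) p = 0}"
        by (simp add: real_matrix_mult_homog int_affine_diff)
    qed
    then have "interior {p. int_affine (row_affine (M $ i) - row_affine (mat 1 $ i)) p = 0} \<noteq> {}"
      using assms interior_mono by blast
    from int_affine_zero_interior[OF this] show ?thesis by simp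
  qed
  then have "M $ i $ j = mat 1 $ i $ j" for i j
    by (cases j) (metis (mono_tags, lifting) fst_conv snd_conv row_affine_def vec_lambda_beta)+
  then show ?thesis by (simp add: vec_eq_iff)
qed

text \<open>A minimum principle: if the form were positive at \<open>y\<close>, moving from its zero
  \<open>x\<close> away from \<open>y\<close> would make it negative.\<close>

lemma int_affine_nonneg_zero_open:
  assumes D: "open D" "\<And>x. x \<in> D \<Longrightarrow> int_affine l x \<ge> 0" and x: "x \<in> D" "int_affine l x = 0" and y: "y \<in> D"
  shows "int_affine l y = 0"
proof -
  obtain e where e: "e > 0" "ball x e \<subseteq> D" using D(1) x(1) openE by blast
  \<comment> \<open>Small enough for the step to stay in the ball; the summand 1 covers the case y =
    x.\<close>
  define t where "t = e / (2 * (1 + norm (y - x)))"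
  have pos: "1 + norm (y - x) > 0" by (simp add: add_pos_nonneg)
  have t: "t > 0" using e(1) pos by (simp add: t_def)
  have "t * norm (y - x) < e"
  proof -
    have "t * norm (y - x) \<le> t * (1 + norm (y - x))" using t by simp
    also have "\<dots> = e / 2" using pos by (simp add: t_def field_simps)
    finally show ?thesis using e(1) by simp
  qed
  then have "x + (- t) *\<^sub>R (y - x) \<in> ball x e" using t by (simp add: dist_norm)
  then have "int_affine l (x + (- t) *\<^sub>R (y - x)) \<ge> 0" using e(2) D(2) by blast
  then have "t * int_affine l y \<le> 0" using x(2) by (simp only: int_affine_toward) simp
  then have "int_affine l y \<le> 0" using t by (simp add: mult_le_0_iff)
  with D(2)[OF y] show ?thesis by simp
qed

text \<open>By \<open>comp\<close>, two pieces that meet at an interior point agree on the whole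
  interior. So the finitely many relatively closed sets where \<open>f\<close> equals a given piece
  coincide or are disjoint, and connectedness leaves one; the closure of the interior gives back the
  cell.\<close>

lemma continuous_piecewise_affine_on_cell:
  fixes f :: "real ^ 'm::finite \<Rightarrow> real"
  assumes L: "finite L" "\<And>p. p \<in> C \<Longrightarrow> \<exists>l\<in>L. f p = int_affine l p" and f: "continuous_on C f"
    and C: "closed C" "convex C" "interior C \<noteq> {}"
    and comp: "\<And>l l'. l \<in> L \<Longrightarrow> l' \<in> L \<Longrightarrow>
      (\<forall>x\<in>C. int_affine l x \<le> int_affine l' x) \<or> (\<forall>x\<in>C. int_affine l' x \<le> int_affine l x)"
  obtains l where "l \<in> L" "\<And>p. p \<in> C \<Longrightarrow> f p = int_affine l p"
proof -
  let ?D = "interior C"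
  have DC: "?D \<subseteq> C" by (rule interior_subset)
  have same: "int_affine l y = int_affine l' y"
    if l: "l \<in> L" "l' \<in> L" and x: "x \<in> ?D" "int_affine l x = int_affine l' x" and y: "y \<in> ?D" for l l' x y
    using comp[OF l]
  proof
    assume "\<forall>x\<in>C. int_affine l x \<le> int_affine l' x"
    then have "int_affine (l' - l) y = 0"
      using DC x by (intro int_affine_nonneg_zero_open[OF open_interior _ x(1) _ y]) (auto simp: int_affine_diff)
    then show ?thesis by (simp add: int_affine_diff)
  next
    assume "\<forall>x\<in>C. int_affine l' x \<le> int_affine l x"
    then have "int_affine (l - l') y = 0"
      using DC x by (intro int_affine_nonneg_zero_open[OF open_interior _ x(1) _ y]) (auto simp: int_affine_diff)
    then show ?thesis by (simp add: int_affine_diff)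
  qed
  obtain x0 where x0: "x0 \<in> ?D" using C(3) by blast
  obtain l0 where l0: "l0 \<in> L" "f x0 = int_affine l0 x0" using L(2) x0 DC by blast
  define X where "X l = {x \<in> ?D. f x = int_affine l x}" for l
  have cX: "closedin (top_of_set ?D) (X l)" for l
  proof -
    have "continuous_on ?D (\<lambda>x. f x - int_affine l x)"
      by (intro continuous_on_diff continuous_on_int_affine continuous_on_subset[OF f DC])
    from continuous_closedin_preimage_constant[OF this, of 0] show ?thesis by (simp add: X_def)
  qed
  let ?V = "\<Union>l\<in>{l \<in> L. X l \<inter> X l0 = {}}. X l"
  have "closedin (top_of_set ?D) ?V"
    using L(1) cX by (intro closedin_Union) auto
  moreover have "?D \<subseteq> X l0 \<union> ?V"
  proof
    fix x assume x: "x \<in> ?D"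
    obtain l where l: "l \<in> L" "f x = int_affine l x" using L(2) x DC by blast
    show "x \<in> X l0 \<union> ?V"
    proof (cases "X l \<inter> X l0 = {}")
      case True
      moreover have "x \<in> X l" using l x by (simp add: X_def)
      ultimately show ?thesis using l(1) by blast
    next
      case False
      then obtain z where "z \<in> ?D" "int_affine l z = int_affine l0 z" unfolding X_def by force
      from same[OF l(1) l0(1) this x] show ?thesis using l x by (simp add: X_def)
    qed
  qed
  moreover have "X l0 \<inter> ?V = {}" by blast
  moreover have "connected ?D" using C(2) by (simp add: convex_connected convex_interior)
  moreover have "X l0 \<noteq> {}" using x0 l0 by (auto simp: X_def)
  ultimately have "?V = {}"
    using cX[of l0] unfolding connected_closedin by blast
  with \<open>?D \<subseteq> X l0 \<union> ?V\<close> have D: "f x = int_affine l0 x" if "x \<in> ?D" for x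
    using that by (auto simp: X_def)
  have "closed {x \<in> C. f x - int_affine l0 x = 0}"
    by (rule continuous_closed_preimage_constant[OF continuous_on_diff[OF f continuous_on_int_affine] C(1)])
  then have "closure ?D \<subseteq> {x \<in> C. f x - int_affine l0 x = 0}"
    using D DC by (intro closure_minimal) auto
  moreover have "closure ?D = C"
    using convex_closure_interior[OF C(2,3)] C(1) by simp
  ultimately show ?thesis using that[OF l0(1)] by auto
qed

lemma dual_map_piecewise_SL:
  fixes \<sigma> :: "(real ^ 'm::finite \<Rightarrow> real) \<Rightarrow> (real ^ 'm \<Rightarrow> real)"
  assumes "orientation_preserving_auto \<sigma>"
  shows "piecewise_SL_homeomorphism (dual_map \<sigma>)"
proof -
  let ?m = "int CARD('m)" and ?S = "dual_map \<sigma>"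
  have \<sigma>: "\<sigma> \<in> hoop_auto G_pos" and op: "orientation_preserving ?S"
    using assms by (auto simp: orientation_preserving_auto_def)
  obtain \<tau> where \<tau>: "\<tau> \<in> hoop_auto G_pos" and inv: "\<And>f. f \<in> carrier G_pos \<Longrightarrow> \<sigma> (\<tau> f) = f"
    "\<And>f. f \<in> carrier G_pos \<Longrightarrow> \<tau> (\<sigma> f) = f"
    using hoop_auto_inverse[OF \<sigma>] by metis
  have hom: "homeomorphism unit_cube unit_cube ?S (dual_map \<tau>)"
    by (rule homeomorphism_dual_map[OF \<sigma> \<tau> inv])
  obtain L where L: "finite L" "\<And>i p. p \<in> unit_cube \<Longrightarrow> \<exists>l\<in>L. homog_image \<sigma> i p = int_affine l p"
    using G_pos_common_pieces[of "homog_image \<sigma>"] homog_image_in_G_pos[OF \<sigma>] by blast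
  \<comment> \<open>The differences make any two pieces comparable on each cell; the axis forms are
    the facets of the cube.\<close>
  define H where "H = (\<lambda>(l, l'). l - l') ` (L \<times> L) \<union> range (\<lambda>i. (axis i 1, 0)) \<union> range (\<lambda>i. (axis i 1, - 1))"
  have H: "finite H" "\<And>i. (axis i 1, 0) \<in> H" "\<And>i. (axis i 1, - 1) \<in> H"
    using L(1) by (auto simp: H_def)
  define K where "K = cube_arrangement H"
  have K: "rational_cell_complex K" "\<Union>K = unit_cube"
    unfolding K_def by (rule rational_cell_complex_cube_arrangement[OF H])+
  have "\<exists>A :: int ^ 'm option ^ 'm option. aff_dim C = ?m \<longrightarrow>
      det A = 1 \<and> (\<forall>p\<in>C. \<exists>c>0. real_matrix A *v homog p = c *\<^sub>R homog (?S p))" if C: "C \<in> K" for C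
  proof (cases "aff_dim C = ?m")
    case True
    have poly: "polytope C" using K(1) C by (auto simp: rational_cell_complex_def)
    have Cc: "C \<subseteq> unit_cube" using K(2) C by blast
    have convex: "convex C" and closed: "closed C"
      using poly polytope_imp_convex polytope_imp_closed by auto
    have int: "interior C \<noteq> {}"
    proof -
      have "affine hull C = UNIV" using True aff_dim_eq_full[of C] by simp
      moreover have "C \<noteq> {}" using True by auto
      ultimately show ?thesis using convex rel_interior_eq_empty rel_interior_interior by metis
    qed
    obtain P N where PN: "C = arrangement_cell P N" "P \<union> N = H"
      using C by (auto simp: K_def cube_arrangement_def)
    have comp: "(\<forall>x\<in>C. int_affine l x \<le> int_affine l' x) \<or> (\<forall>x\<in>C. int_affine l' x \<le> int_affine l x)"
      if "l \<in> L" "l' \<in> L" for l l'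
    proof -
      have "l - l' \<in> P \<union> N" unfolding PN(2) H_def using that by force
      then have "(\<forall>x\<in>C. int_affine (l - l') x \<ge> 0) \<or> (\<forall>x\<in>C. int_affine (l - l') x \<le> 0)"
        unfolding PN(1) arrangement_cell_def by blast
      then show ?thesis by (auto simp: int_affine_diff)
    qed
    have "\<exists>l. \<forall>p\<in>C. homog_image \<sigma> i p = int_affine l p" for i
    proof -
      have c: "continuous_on C (homog_image \<sigma> i)"
        using continuous_on_G_pos[OF homog_image_in_G_pos[OF \<sigma>]] Cc continuous_on_subset by blast
      have "\<exists>l\<in>L. homog_image \<sigma> i p = int_affine l p" if "p \<in> C" for p
        using L(2) Cc that by blast
      from continuous_piecewise_affine_on_cell[OF L(1) this c closed convex int comp] show ?thesis
        by metis
    qed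
    then obtain l where l: "\<And>i p. p \<in> C \<Longrightarrow> homog_image \<sigma> i p = int_affine (l i) p" by metis
    define A :: "int ^ 'm option ^ 'm option" where "A = (\<chi> i. affine_row (l i))"
    have A: "real_matrix A *v homog p = \<sigma> one_fun p *\<^sub>R homog (?S p)" if p: "p \<in> C" for p
    proof (rule vec_eq_iff[THEN iffD2, OF allI])
      fix i
      have "(real_matrix A *v homog p) $ i = int_affine (l i) p"
        by (simp only: real_matrix_mult_homog A_def vec_lambda_beta row_affine_affine_row)
      then show "(real_matrix A *v homog p) $ i = (\<sigma> one_fun p *\<^sub>R homog (?S p)) $ i"
        using l[OF p, of i] homog_image_eq[OF \<sigma>, of p i] p Cc by auto
    qed
    have pos: "\<exists>c>0. real_matrix A *v homog p = c *\<^sub>R homog (?S p)" if "p \<in> C" for p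
      using A[OF that] hoop_auto_evaluation(2)[OF \<sigma>, of p] Cc that by blast
    obtain M where M: "finite M"
      "\<And>q. q \<in> unit_cube \<Longrightarrow> \<exists>B\<in>M. real_matrix B *v homog q = \<tau> one_fun q *\<^sub>R homog (dual_map \<tau> q)"
      using hoop_auto_finite_matrices[OF \<tau>] by blast
    \<comment> \<open>The finitely many closed sets \<open>X B\<close> cover \<open>C\<close>, so
      one of them has interior points, which forces \<open>B ** A = mat 1\<close>.\<close>
    define X where "X B = {p. real_matrix (B ** A) *v homog p = homog p}" for B
    have "C \<subseteq> \<Union> (X ` M)"
    proof
      fix p assume p: "p \<in> C"
      then have pc: "p \<in> unit_cube" using Cc by blast
      obtain B where B: "B \<in> M" "real_matrix B *v homog (?S p) = \<tau> one_fun (?S p) *\<^sub>R homog (dual_map \<tau> (?S p))"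
        using M(2)[OF hoop_auto_evaluation(1)[OF \<sigma> pc]] by blast
      have "real_matrix (B ** A) *v homog p = real_matrix B *v (\<sigma> one_fun p *\<^sub>R homog (?S p))"
        by (simp add: real_matrix_mult matrix_vector_mul_assoc flip: A[OF p])
      also have "\<dots> = (\<sigma> one_fun p * \<tau> one_fun (?S p)) *\<^sub>R homog (dual_map \<tau> (?S p))"
        by (simp add: matrix_vector_mult_scaleR B(2))
      also have "\<dots> = homog p"
        by (simp add: dual_map_inverse[OF \<sigma> \<tau> inv(1) pc])
      finally show "p \<in> \<Union> (X ` M)" using B(1) by (auto simp: X_def)
    qed
    then have ne: "interior (\<Union> (X ` M)) \<noteq> {}" using int interior_mono by blast
    have closedX: "closed (X B)" for B
    proof -
      have "X B = (\<Inter>i. {p. int_affine (row_affine ((B ** A) $ i)) p = homog p $ i})"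
        by (auto simp: X_def vec_eq_iff real_matrix_mult_homog)
      moreover have "closed {p. int_affine (row_affine ((B ** A) $ i)) p = homog p $ i}" for i
      proof (rule closed_Collect_eq)
        show "continuous_on UNIV (\<lambda>p. homog p $ i)" by (cases i) (auto intro!: continuous_intros)
      qed (rule continuous_on_int_affine)
      ultimately show ?thesis by auto
    qed
    obtain B where "B \<in> M" "interior (X B) \<noteq> {}"
      using interior_finite_Union_empty[of "X ` M"] M(1) closedX ne by blast
    then have BA: "B ** A = mat 1"
      unfolding X_def by (intro real_matrix_fixing_open_set) auto
    \<comment> \<open>An integer dividing 1 is 1 or -1; the orientation excludes -1.\<close>
    have "det B * det A = 1" using arg_cong[OF BA, of det] by (simp add: det_mul)
    moreover obtain p where "p \<in> interior C" using int by blast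
    from orientation_preserving_imp_det_nonneg[OF hom op this Cc pos]
    have "det A \<ge> 0" by (simp add: det_real_matrix)
    ultimately have "det A = 1" by (metis abs_of_nonneg dvd_triv_right zdvd1_eq)
    with pos show ?thesis by blast
  qed simp
  then obtain A :: "(real ^ 'm) set \<Rightarrow> int ^ 'm option ^ 'm option" where
    "\<forall>C\<in>K. aff_dim C = ?m \<longrightarrow> det (A C) = 1 \<and> (\<forall>p\<in>C. \<exists>c>0. real_matrix (A C) *v homog p = c *\<^sub>R homog (?S p))"
    by metis
  with hom op K show ?thesis unfolding piecewise_SL_homeomorphism_def by blast
qed

text \<open>\<open>dual_map \<sigma>\<close> and a given \<open>S\<close> are only known to agree on
  the cube.\<close>

lemma orientation_preserving_cong:
  assumes "\<And>p. p \<in> unit_cube \<Longrightarrow> S p = S' p"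
  shows "orientation_preserving S \<longleftrightarrow> orientation_preserving S'"
  unfolding orientation_preserving_def
  using hom_induced_eq[of "top_of_set unit_cube" S S'] assms by simp

theorem theorem4p2:
  shows "(\<forall>\<sigma> :: (real ^ 'm::finite \<Rightarrow> real) \<Rightarrow> (real ^ 'm \<Rightarrow> real).
            orientation_preserving_auto \<sigma> \<longrightarrow> piecewise_SL_homeomorphism (dual_map \<sigma>)) \<and>
         (\<forall>S :: real ^ 'm \<Rightarrow> real ^ 'm.
            piecewise_SL_homeomorphism S \<longrightarrow>
            (\<exists>!\<sigma>. orientation_preserving_auto \<sigma> \<and> (\<forall>p\<in>unit_cube. dual_map \<sigma> p = S p)))"
proof (intro conjI allI impI)
  fix \<sigma> :: "(real ^ 'm \<Rightarrow> real) \<Rightarrow> (real ^ 'm \<Rightarrow> real)"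
  assume "orientation_preserving_auto \<sigma>"
  then show "piecewise_SL_homeomorphism (dual_map \<sigma>)" by (rule dual_map_piecewise_SL)
next
  fix S :: "real ^ 'm \<Rightarrow> real ^ 'm"
  assume S: "piecewise_SL_homeomorphism S"
  obtain \<sigma> where \<sigma>: "\<sigma> \<in> hoop_auto G_pos" "\<And>p. p \<in> unit_cube \<Longrightarrow> dual_map \<sigma> p = S p"
    using piecewise_SL_is_dual_map[OF S] by blast
  show "\<exists>!\<sigma>. orientation_preserving_auto \<sigma> \<and> (\<forall>p\<in>unit_cube. dual_map \<sigma> p = S p)"
  proof (rule ex1I[of _ \<sigma>])
    have "orientation_preserving (dual_map \<sigma>)"
      using S orientation_preserving_cong[of "dual_map \<sigma>" S] \<sigma>(2)
      by (simp add: piecewise_SL_homeomorphism_def)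
    then show "orientation_preserving_auto \<sigma> \<and> (\<forall>p\<in>unit_cube. dual_map \<sigma> p = S p)"
      using \<sigma> by (simp add: orientation_preserving_auto_def)
    fix \<sigma>' :: "(real ^ 'm \<Rightarrow> real) \<Rightarrow> (real ^ 'm \<Rightarrow> real)"
    assume "orientation_preserving_auto \<sigma>' \<and> (\<forall>p\<in>unit_cube. dual_map \<sigma>' p = S p)"
    then show "\<sigma>' = \<sigma>"
      using \<sigma> by (intro hoop_auto_unique) (auto simp: orientation_preserving_auto_def)
  qed
qed

end
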